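(* Let $\mathbf u=\begin{bmatrix} a\\ b\end{bmatrix}$ and $\mathbf v=\begin{bmatrix} c\\ d\end{bmatrix}$ be two neighboring spinors in the corona around a disk of curvature $B$ in an Apollonian disk packing (that is, tangency spinors oriented from this disk towards two mutually tangent disks of its corona). Let $$M=[\mathbf u|\mathbf v]=\begin{bmatrix} a& c\\ b& d\end{bmatrix},\qquad \mathbf f=\begin{bmatrix} m\\ n\end{bmatrix}.$$ Then the quadratic polynomial $$P(m,n)=\mathbf f^T(M^TM)\,\mathbf f-B$$ reproduces all curvatures in the corona of the disk of curvature $B$, with $(m,n)\in\mathbb Z^2$ running over all pairs of coprime integers, including $(\pm1,0)$ and $(0,\pm1)$. Each curvature appears in the range of the polynomial twice, due to $P(\mathbf f)=P(-\mathbf f)$.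
   Context: Disks. Disks in the plane $\mathbb R^2\cong\mathbb C$ are understood in the generalized sense: an ordinary round disk of radius $r>0$ has curvature $1/r$; the unbounded region outside a circle of radius $r>0$ is a disk of curvature $-1/r$ (with the same center as the circle); a half-plane is a disk of curvature $0$. Tangent disks are always tangent externally (disjoint interiors); two parallel half-planes with disjoint interiors count as tangent. An Apollonian disk packing is the infinite arrangement of disks determined by three mutually tangent disks by recurrently adjoining, for every three mutually tangent disks present, the disks tangent to all three. The corona of a disk in the packing is the set of all disks of the packing tangent to it. Tangency spinor. For an ordered pair of tangent disks of curvatures $A_1$ and $A_2$, the tangency spinor is $u=\pm\sqrt{A_1A_2\,z}$, where $z\in\mathbb C$ represents the vector joining the center of the first disk to the center of the second. It is defined up to sign and satisfies $|u|^2=A_1+A_2$. Equivalently, $u^2=(A_1+A_2)e$, where $e$ is the unit normal at the tangency point pointing out of the first disk; this form also makes sense when one of the disks is a half-plane (and $u=0$ if both are). The complex number $u=p+qi$ is identified with the vector $\begin{bmatrix} p\\ q\end{bmatrix}\in\mathbb R^2$. *)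

theory Defs
  imports "HOL-Analysis.Analysis"
begin

text \<open>Generalized disks in the plane, identified with the complex numbers.
  \<open>Round_Disk c r\<close> is the disk with center \<open>c\<close> and radius \<open>r\<close>, \<open>Outer_Disk c r\<close> is the
  unbounded region outside that circle, and \<open>Half_Plane e t\<close> is the half-plane
  with outward unit normal \<open>e\<close> consisting of the points \<open>x\<close> with \<open>e \<bullet> x \<le> t\<close>.
  Under \<open>is_disk\<close> below, different terms denote different regions.\<close>

datatype gdisk =
    Round_Disk complex real
  | Outer_Disk complex real
  | Half_Plane complex real

fun is_disk :: "gdisk \<Rightarrow> bool" where
  "is_disk (Round_Disk c r) \<longleftrightarrow> r > 0"
| "is_disk (Outer_Disk c r) \<longleftrightarrow> r > 0"
| "is_disk (Half_Plane e t) \<longleftrightarrow> norm e = 1"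

fun region :: "gdisk \<Rightarrow> complex set" where
  "region (Round_Disk c r) = cball c r"
| "region (Outer_Disk c r) = - ball c r"
| "region (Half_Plane e t) = {x. e \<bullet> x \<le> t}"

fun curvature :: "gdisk \<Rightarrow> real" where
  "curvature (Round_Disk c r) = 1 / r"
| "curvature (Outer_Disk c r) = - 1 / r"
| "curvature (Half_Plane e t) = 0"

fun is_half_plane :: "gdisk \<Rightarrow> bool" where
  "is_half_plane (Half_Plane e t) \<longleftrightarrow> True"
| "is_half_plane _ \<longleftrightarrow> False"

text \<open>Only meaningful for disks that are not half-planes.\<close>

fun center :: "gdisk \<Rightarrow> complex" where
  "center (Round_Disk c r) = c"
| "center (Outer_Disk c r) = c"
| "center (Half_Plane e t) = 0"

text \<open>The unit normal at a boundary point \<open>p\<close>, pointing out of the disk.\<close>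

fun outward_normal :: "gdisk \<Rightarrow> complex \<Rightarrow> complex" where
  "outward_normal (Round_Disk c r) p = (p - c) / of_real r"
| "outward_normal (Outer_Disk c r) p = (c - p) / of_real r"
| "outward_normal (Half_Plane e t) p = e"

text \<open>External tangency. Half-planes with disjoint interiors are automatically parallel
  and count as tangent by convention. (A half-plane and its complement also satisfy the
  convention, but they have no common tangent disk, so they never occur together in a
  packing.) A round disk and the outer disk of the same circle are not tangent.\<close>

definition tangent :: "gdisk \<Rightarrow> gdisk \<Rightarrow> bool" where
  "tangent D E \<longleftrightarrow>
     interior (region D) \<inter> interior (region E) = {} \<and>
     ((\<exists>p. region D \<inter> region E = {p}) \<or> (is_half_plane D \<and> is_half_plane E))"

definition mutually_tangent :: "gdisk \<Rightarrow> gdisk \<Rightarrow> gdisk \<Rightarrow> bool" where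
  "mutually_tangent X Y Z \<longleftrightarrow> tangent X Y \<and> tangent Y Z \<and> tangent X Z"

inductive_set packing :: "gdisk \<Rightarrow> gdisk \<Rightarrow> gdisk \<Rightarrow> gdisk set"
  for D1 D2 D3 :: gdisk where
  first: "D1 \<in> packing D1 D2 D3"
| second: "D2 \<in> packing D1 D2 D3"
| third: "D3 \<in> packing D1 D2 D3"
| adjoin: "W \<in> packing D1 D2 D3"
    if "X \<in> packing D1 D2 D3" "Y \<in> packing D1 D2 D3" "Z \<in> packing D1 D2 D3"
       "mutually_tangent X Y Z" "is_disk W" "tangent W X" "tangent W Y" "tangent W Z"

definition apollonian_packing :: "gdisk set \<Rightarrow> bool" where
  "apollonian_packing \<A> \<longleftrightarrow>
     (\<exists>D1 D2 D3. is_disk D1 \<and> is_disk D2 \<and> is_disk D3 \<and> mutually_tangent D1 D2 D3 \<and>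
        \<A> = packing D1 D2 D3)"

definition corona :: "gdisk set \<Rightarrow> gdisk \<Rightarrow> gdisk set" where
  "corona \<A> D = {E \<in> \<A>. tangent D E}"

text \<open>\<open>tangency_spinor D E u\<close>: \<open>u\<close> is one of the two spinors, differing by a sign, of
  the ordered pair of tangent disks \<open>D\<close>, \<open>E\<close>. The normal form is used only if a center is
  missing; for disks with centers the two forms agree, see \<open>tangency_spinor_normal_form\<close>.\<close>

definition tangency_spinor :: "gdisk \<Rightarrow> gdisk \<Rightarrow> complex \<Rightarrow> bool" where
  "tangency_spinor D E u \<longleftrightarrow>
     (if \<not> is_half_plane D \<and> \<not> is_half_plane E then
        u\<^sup>2 = of_real (curvature D * curvature E) * (center E - center D)
      else if is_half_plane D \<and> is_half_plane E then u = 0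
      else \<exists>p \<in> region D \<inter> region E.
             u\<^sup>2 = of_real (curvature D + curvature E) * outward_normal D p)"

lemma tangency_spinor_normal_form:
  assumes "is_disk D" "is_disk E" "tangent D E" "p \<in> region D \<inter> region E"
    and nhp: "\<not> is_half_plane D" "\<not> is_half_plane E"
  shows "tangency_spinor D E u \<longleftrightarrow>
    u\<^sup>2 = of_real (curvature D + curvature E) * outward_normal D p"
proof -
  have key: "of_real (curvature D * curvature E) * (center E - center D)
      = of_real (curvature D + curvature E) * outward_normal D p"
  proof (cases D; cases E)
    fix c r c' r' assume DE: "D = Round_Disk c r" "E = Round_Disk c' r'"
    have r: "r > 0" "r' > 0" using assms DE by auto
    have dj: "ball c r \<inter> ball c' r' = {}" using assms DE by (auto simp: tangent_def)
    have p: "dist c p \<le> r" "dist c' p \<le> r'" using assms DE by auto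
    have "r + r' \<le> dist c c'"
    proof (rule ccontr)
      assume h: "\<not> r + r' \<le> dist c c'"
      define q where "q = c + (r / (r + r')) *\<^sub>R (c' - c)"
      have "c' - q = (r' / (r + r')) *\<^sub>R (c' - c)"
      proof -
        have "r' / (r + r') = 1 - r / (r + r')" using r by (simp add: field_simps)
        then show ?thesis by (simp add: q_def scaleR_left_diff_distrib)
      qed
      then have "dist c' q = r' / (r + r') * dist c c'" using r
        by (simp add: dist_norm norm_minus_commute)
      moreover have "dist c q = r / (r + r') * dist c c'" using r
        by (simp add: q_def dist_norm norm_minus_commute)
      moreover have "x / (r + r') * dist c c' < x" if "x > 0" for x
        using h r mult_strict_left_mono[of "dist c c'" "r + r'" x] that
        by (simp add: field_simps)
      ultimately have "q \<in> ball c r \<inter> ball c' r'" using r by auto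
      then show False using dj by auto
    qed
    then have e: "dist c p = r" "dist p c' = r'" "dist c p + dist p c' = dist c c'"
      using p dist_triangle[of c c' p] by (auto simp: dist_commute)
    then have "r *\<^sub>R (p - c') = r' *\<^sub>R (c - p)"
      using e(3)[symmetric, unfolded dist_triangle_eq] by (simp add: dist_norm)
    then have eq: "of_real r * (p - c') = of_real r' * (c - p)"
      by (simp add: scaleR_conv_of_real)
    then have "of_real r * (c' - c) = (of_real r + of_real r') * (p - c)"
      by (simp add: algebra_simps)
    then show ?thesis using r DE by (simp add: divide_simps) (simp add: algebra_simps)
  next
    fix c r c' r' assume DE: "D = Outer_Disk c r" "E = Round_Disk c' r'"
    have r: "r > 0" "r' > 0" using assms DE by auto
    have "ball c' r' \<subseteq> cball c r" using assms DE by (auto simp: tangent_def interior_diff interior_complement)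
    then have l: "dist c' c + r' \<le> r" using r by (simp add: ball_subset_cball_iff)
    have p: "dist c p \<ge> r" "dist c' p \<le> r'" using assms DE by auto
    have e: "dist c c' = r - r'" "dist c' p = r'" "dist c c' + dist c' p = dist c p"
      using l p dist_triangle[of c p c'] by (auto simp: dist_commute)
    then have "(r - r') *\<^sub>R (c' - p) = r' *\<^sub>R (c - c')"
      using e(3)[symmetric, unfolded dist_triangle_eq] by (simp add: dist_norm)
    then have eq: "(of_real r - of_real r') * (c' - p) = of_real r' * (c - c')"
      by (simp add: scaleR_conv_of_real)
    then have "of_real r * (c - c') = (of_real r - of_real r') * (c - p)"
      by (simp add: algebra_simps)
    then show ?thesis using r DE by (simp add: divide_simps) (simp add: algebra_simps)
  next
    fix c r c' r' assume DE: "D = Round_Disk c r" "E = Outer_Disk c' r'"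
    have r: "r > 0" "r' > 0" using assms DE by auto
    have "ball c r \<subseteq> cball c' r'" using assms DE by (auto simp: tangent_def interior_diff interior_complement)
    then have l: "dist c c' + r \<le> r'" using r by (simp add: ball_subset_cball_iff)
    have p: "dist c' p \<ge> r'" "dist c p \<le> r" using assms DE by auto
    have e: "dist c' c = r' - r" "dist c p = r" "dist c' c + dist c p = dist c' p"
      using l p dist_triangle[of c' p c] by (auto simp: dist_commute)
    then have "(r' - r) *\<^sub>R (c - p) = r *\<^sub>R (c' - c)"
      using e(3)[symmetric, unfolded dist_triangle_eq] by (simp add: dist_norm)
    then have eq: "(of_real r' - of_real r) * (c - p) = of_real r * (c' - c)"
      by (simp add: scaleR_conv_of_real)
    then show ?thesis using r DE by (simp add: divide_simps) (simp add: algebra_simps)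
  next
    fix c r c' r' assume DE: "D = Outer_Disk c r" "E = Outer_Disk c' r'"
    have "- cball c r \<inter> - cball c' r' = {}"
      using assms DE by (auto simp: tangent_def interior_complement)
    then have "UNIV = cball c r \<union> cball c' r'" by blast
    then have "bounded (UNIV :: complex set)" by (metis bounded_Un bounded_cball)
    then show ?thesis by simp
  qed (use nhp in auto)
  show ?thesis unfolding tangency_spinor_def using nhp key by simp
qed

end

theory Submission
  imports Defs
begin

text \<open>A disk is encoded by its curvature, curvature times center, and co-curvature, a unit vector of
  a Lorentzian space in which tangency means product \<open>-1\<close>. For \<open>E\<close> tangent to \<open>D\<close> the vector
  \<open>D + E\<close> is null and orthogonal to \<open>D\<close>, and the null cone of this three-dimensional complement is
  parametrized by the spinors \<open>(s, t)\<close> up to sign: the disk \<open>E(s, t)\<close> is affine in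
  \<open>s\<^sup>2\<close>, \<open>t\<^sup>2\<close>, \<open>s t\<close>, and the product of \<open>E(s, t)\<close> and \<open>E(s', t')\<close> is
  \<open>1 - 2 (s t' - t s')\<^sup>2\<close>. Euclid's algorithm places all coprime \<open>(m, n)\<close> in the packing.
  Conversely, distinct disks of a packing have product at most \<open>-1\<close>, which is seen by following
  reduced words in the swaps of a Descartes quadruple; since every real \<open>(s, t)\<close> satisfies
  \<open>(s n - t m)\<^sup>2 < 1\<close> for some coprime \<open>(m, n)\<close> by Dirichlet's theorem, every disk of the corona
  is one of the \<open>E(m, n)\<close>.\<close>

section \<open>Lorentzian frames and Descartes quadruples\<close>

type_synonym lorentz = "real \<times> complex \<times> real"

definition lor :: "lorentz \<Rightarrow> lorentz \<Rightarrow> real" where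
  "lor x y = fst (snd x) \<bullet> fst (snd y) - (fst x * snd (snd y) + fst y * snd (snd x)) / 2"

lemma lor_commute: "lor x y = lor y x"
  by (simp add: lor_def inner_commute)

lemma lor_linear [simp]:
  "lor (x + y) z = lor x z + lor y z" "lor z (x + y) = lor z x + lor z y"
  "lor (x - y) z = lor x z - lor y z" "lor z (x - y) = lor z x - lor z y"
  "lor (r *\<^sub>R x) z = r * lor x z" "lor z (r *\<^sub>R x) = r * lor z x"
  "lor (- x) z = - lor x z" "lor z (- x) = - lor z x"
  "lor 0 z = 0" "lor z 0 = 0"
  by (simp_all add: lor_def inner_simps field_simps)

lemma spacelike_if_orthogonal_to_timelike:
  assumes "lor u u < 0" "lor v u = 0" "v \<noteq> 0"
  shows "lor v v > 0"
proof (rule ccontr)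
  obtain a z c where u: "u = (a, z, c)" by (metis prod.exhaust)
  obtain A w C where v: "v = (A, w, C)" by (metis prod.exhaust)
  have zz: "z \<bullet> z < a * c" and wz: "w \<bullet> z = (A * c + a * C) / 2"
    using assms u v by (auto simp: lor_def)
  assume "\<not> lor v v > 0"
  then have ww: "w \<bullet> w \<le> A * C" by (simp add: v lor_def)
  have "(A * c + a * C)\<^sup>2 = 4 * (w \<bullet> z)\<^sup>2" by (simp add: wz power_divide)
  also have "\<dots> \<le> 4 * ((w \<bullet> w) * (z \<bullet> z))"
    using Cauchy_Schwarz_ineq[of w z] by simp
  finally have le: "(A * c + a * C)\<^sup>2 \<le> 4 * ((w \<bullet> w) * (z \<bullet> z))" .
  have "4 * ((w \<bullet> w) * (z \<bullet> z)) \<le> 4 * ((A * C) * (z \<bullet> z))"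
    using ww by (simp add: mult_right_mono)
  moreover have "(A * c + a * C)\<^sup>2 = (A * c - a * C)\<^sup>2 + 4 * ((A * C) * (a * c))"
    by algebra
  ultimately have *: "(A * c - a * C)\<^sup>2 + 4 * ((A * C) * (a * c - z \<bullet> z)) \<le> 0"
    using le by (simp add: algebra_simps)
  have AC: "A * C \<ge> 0" using ww inner_ge_zero[of w] by linarith
  then have "(A * C) * (a * c - z \<bullet> z) \<ge> 0" using zz by simp
  then have "(A * c - a * C)\<^sup>2 = 0" "(A * C) * (a * c - z \<bullet> z) = 0"
    using * zero_le_power2[of "A * c - a * C"] by linarith+
  then have eq: "A * c = a * C" "A * C = 0" using zz by auto
  then have "w \<bullet> w \<le> 0" using ww by linarith
  then have w: "w = 0" using inner_ge_zero[of w] by simp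
  have "a * c > 0" using zz inner_ge_zero[of z] by linarith
  then have "a \<noteq> 0" "c \<noteq> 0" by auto
  then have "A = 0" "C = 0" using eq by auto
  then show False using w v assms(3) by (simp add: zero_prod_def)
qed

lemma orthonormal_frame:
  assumes "lor x x = 1" "lor y y = 1" "lor z z = 1"
    and "lor x y = -1" "lor x z = -1" "lor y z = -1"
  obtains k where "lor k k = 1" "lor k x = 0" "lor k y = 0" "lor k z = 0"
    and "\<And>v. v = lor v x *\<^sub>R x - (lor v (x + z) / 2) *\<^sub>R (x + y)
           - (lor v (x + y) / 2) *\<^sub>R (x + z) + lor v k *\<^sub>R k"
proof -
  have sym: "lor y x = -1" "lor z x = -1" "lor z y = -1"
    using assms by (simp_all add: lor_commute)
  define f :: "lorentz \<Rightarrow> lorentz" where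
    "f v = (lor v x, Complex (lor v y) (lor v z), 0)" for v
  have f: "linear f"
    by (rule linearI) (auto simp: f_def complex_eq_iff)
  have "\<not> surj f"
  proof
    assume "surj f"
    then obtain v where "f v = (0, 0, 1)" by (metis surjD)
    then show False by (simp add: f_def)
  qed
  then have "\<not> inj f" using f linear_injective_imp_surjective by blast
  then obtain k0 where "f k0 = 0" "k0 \<noteq> 0"
    using linear_injective_0[OF f] by blast
  then have k0: "lor k0 x = 0" "lor k0 y = 0" "lor k0 z = 0"
    by (auto simp: f_def zero_prod_def complex_eq_iff)
  have pos: "lor k0 k0 > 0"
    by (rule spacelike_if_orthogonal_to_timelike[of "x + y + z"])
       (use k0 assms sym \<open>k0 \<noteq> 0\<close> in auto)
  define k where "k = (1 / sqrt (lor k0 k0)) *\<^sub>R k0"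
  have k: "lor k k = 1" "lor k x = 0" "lor k y = 0" "lor k z = 0"
    using pos k0 by (auto simp: k_def)
  then have k': "lor x k = 0" "lor y k = 0" "lor z k = 0" by (simp_all add: lor_commute)
  define g :: "lorentz \<Rightarrow> lorentz" where
    "g t = fst t *\<^sub>R x + Re (fst (snd t)) *\<^sub>R (x + y) + Im (fst (snd t)) *\<^sub>R (x + z)
       + snd (snd t) *\<^sub>R k" for t
  have g: "linear g"
    by (rule linearI) (auto simp: g_def algebra_simps)
  have lg: "lor (g t) x = fst t" "lor (g t) k = snd (snd t)"
      "lor (g t) (x + y) = - 2 * Im (fst (snd t))" "lor (g t) (x + z) = - 2 * Re (fst (snd t))" for t
    using assms sym k k' by (auto simp: g_def algebra_simps)
  have "t = 0" if "g t = 0" for t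
    using lg[of t] that by (auto simp: prod_eq_iff complex_eq_iff)
  then have "surj g"
    using g linear_injective_0[OF g] linear_injective_imp_surjective by blast
  have expand: "v = lor v x *\<^sub>R x - (lor v (x + z) / 2) *\<^sub>R (x + y)
           - (lor v (x + y) / 2) *\<^sub>R (x + z) + lor v k *\<^sub>R k" for v
  proof -
    obtain t where t: "v = g t" using \<open>surj g\<close> by (metis surjD)
    show ?thesis unfolding t lg by (simp add: g_def)
  qed
  show thesis by (rule that[OF k expand])
qed

lemma two_fourth_vectors:
  assumes "lor x x = 1" "lor y y = 1" "lor z z = 1"
    and "lor x y = -1" "lor x z = -1" "lor y z = -1"
    and "lor v v = 1" "lor v x = -1" "lor v y = -1" "lor v z = -1"
    and "lor w w = 1" "lor w x = -1" "lor w y = -1" "lor w z = -1"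
  shows "w = v \<or> w = 2 *\<^sub>R (x + y + z) - v"
proof -
  obtain k where k: "lor k k = 1" "lor k x = 0" "lor k y = 0" "lor k z = 0"
    and ex: "\<And>v. v = lor v x *\<^sub>R x - (lor v (x + z) / 2) *\<^sub>R (x + y)
           - (lor v (x + y) / 2) *\<^sub>R (x + z) + lor v k *\<^sub>R k"
    by (rule orthonormal_frame[OF assms(1-6)]) (rule that)
  have sym: "lor y x = -1" "lor z x = -1" "lor z y = -1"
    "lor x k = 0" "lor y k = 0" "lor z k = 0"
    using assms k by (simp_all add: lor_commute)
  have form: "v = x + y + z + lor v k *\<^sub>R k \<and> (lor v k)\<^sup>2 = 4"
    if "lor v v = 1" "lor v x = -1" "lor v y = -1" "lor v z = -1" for v
  proof -
    define h where "h = lor v k"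
    have v: "v = x + y + z + h *\<^sub>R k"
      using ex[of v] that by (simp add: h_def algebra_simps)
    have "lor v v = -3 + h\<^sup>2"
      unfolding v using assms(1-6) sym k by (simp add: power2_eq_square)
    then have "h\<^sup>2 = 4" using that by linarith
    then show ?thesis using v unfolding h_def by blast
  qed
  note v = form[OF assms(7-10)] and w = form[OF assms(11-14)]
  have "(lor w k)\<^sup>2 = (lor v k)\<^sup>2" using conjunct2[OF v] conjunct2[OF w] by simp
  then have "lor w k = lor v k \<or> lor w k = - lor v k" by (simp add: power2_eq_iff)
  then show ?thesis
  proof
    assume "lor w k = lor v k"
    then show ?thesis using v w by metis
  next
    assume "lor w k = - lor v k"
    then have "w + v = (x + y + z - lor v k *\<^sub>R k) + (x + y + z + lor v k *\<^sub>R k)"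
      using conjunct1[OF v] conjunct1[OF w] by (metis diff_conv_add_uminus scaleR_minus_left)
    then show ?thesis by (simp add: scaleR_2 algebra_simps)
  qed
qed

definition descartes :: "(nat \<Rightarrow> lorentz) \<Rightarrow> bool" where
  "descartes q \<longleftrightarrow> (\<forall>i<4. \<forall>j<4. lor (q i) (q j) = (if i = j then 1 else -1))"

definition swap :: "nat \<Rightarrow> (nat \<Rightarrow> lorentz) \<Rightarrow> nat \<Rightarrow> lorentz" where
  "swap i q = q(i := 2 *\<^sub>R (\<Sum>k\<in>{..<4} - {i}. q k) - q i)"

lemma lor_sum: "lor x (\<Sum>k\<in>K. q k) = (\<Sum>k\<in>K. lor x (q k))"
  by (induction K rule: infinite_finite_induct) auto

lemma lor_swap:
  "lor x (swap i q i) = 2 * (\<Sum>k\<in>{..<4} - {i}. lor x (q k)) - lor x (q i)"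
  by (simp add: swap_def lor_sum)

lemma swap_other: "j \<noteq> i \<Longrightarrow> swap i q j = q j"
  by (simp add: swap_def)

lemma swap_swap: "swap i (swap i q) = q"
proof -
  have "(\<Sum>k\<in>{..<4} - {i}. swap i q k) = (\<Sum>k\<in>{..<4} - {i}. q k)"
    by (rule sum.cong) (auto simp: swap_def)
  then show ?thesis by (auto simp: swap_def)
qed

lemma descartes_sum:
  assumes "descartes q" "i < 4" "j < 4"
  shows "(\<Sum>k\<in>{..<4} - {i}. lor (q j) (q k)) = (if i = j then -3 else -1)"
proof -
  have "(\<Sum>k\<in>{..<4} - {i}. lor (q j) (q k)) = (\<Sum>k\<in>{..<4} - {i}. if k = j then 1 else -1)"
    using assms by (intro sum.cong) (auto simp: descartes_def)
  also have "\<dots> = (\<Sum>k\<in>{..<4} - {i}. (if k = j then 2 else 0) - 1)"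
    by (intro sum.cong) auto
  also have "\<dots> = (if i = j then -3 else -1)"
    using assms by (simp add: sum_subtractf)
  finally show ?thesis .
qed

lemma descartes_swap:
  assumes q: "descartes q" and i: "i < 4" shows "descartes (swap i q)"
proof -
  have new: "lor (q j) (swap i q i) = -1" if "j < 4" "j \<noteq> i" for j
    using q i that by (simp add: lor_swap descartes_sum) (simp add: descartes_def)
  have old: "lor (q i) (swap i q i) = -7"
    using q i by (simp add: lor_swap descartes_sum) (simp add: descartes_def)
  have "(\<Sum>k\<in>{..<4} - {i}. lor (swap i q i) (q k)) = (\<Sum>k\<in>{..<4} - {i}. - 1)"
    using new by (intro sum.cong) (auto simp: lor_commute)
  then have "lor (swap i q i) (swap i q i) = 1"
    using old i by (simp add: lor_swap lor_commute)
  moreover have "lor (swap i q i) (q j) = -1" if "j < 4" "j \<noteq> i" for j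
    using new[OF that] by (simp add: lor_commute)
  moreover have "lor (swap i q j) (swap i q k) = (if j = k then 1 else -1)"
    if "j < 4" "k < 4" "j \<noteq> i" "k \<noteq> i" for j k
    using q that by (simp add: swap_other descartes_def)
  ultimately have "lor (swap i q j) (swap i q k) = (if j = k then 1 else -1)"
    if "j < 4" "k < 4" for j k
    using that new by (cases "j = i"; cases "k = i") (simp_all add: swap_other)
  then show ?thesis by (simp add: descartes_def)
qed

definition swap_step :: "(nat \<Rightarrow> lorentz) \<Rightarrow> (nat \<Rightarrow> lorentz) \<Rightarrow> bool" where
  "swap_step q q' \<longleftrightarrow> (\<exists>i<4. q' = swap i q)"

lemma swap_steps_sym:
  assumes "swap_step\<^sup>*\<^sup>* q q'" shows "swap_step\<^sup>*\<^sup>* q' q"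
proof -
  have "symp swap_step"
  proof (rule sympI)
    fix q q' assume "swap_step q q'"
    then obtain i where "i < 4" "q' = swap i q" by (auto simp: swap_step_def)
    then show "swap_step q' q"
      unfolding swap_step_def by (intro exI[of _ i]) (simp add: swap_swap)
  qed
  then show ?thesis using assms by (blast dest: symp_rtranclp sympD)
qed

lemma descartes_swap_steps: "swap_step\<^sup>*\<^sup>* q q' \<Longrightarrow> descartes q \<Longrightarrow> descartes q'"
  by (induction rule: rtranclp_induct) (auto simp: swap_step_def descartes_swap)

text \<open>Reduced words in the swaps; the last argument records the most recent swap, with the
  dummy value \<open>4\<close> for the empty word.\<close>

inductive reduced :: "(nat \<Rightarrow> lorentz) \<Rightarrow> (nat \<Rightarrow> lorentz) \<Rightarrow> nat \<Rightarrow> bool" for q0 where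
  empty: "reduced q0 q0 4"
| snoc: "reduced q0 q j \<Longrightarrow> i < 4 \<Longrightarrow> i \<noteq> j \<Longrightarrow> reduced q0 (swap i q) i"

lemma reduced_swap_steps: "reduced q0 q j \<Longrightarrow> swap_step\<^sup>*\<^sup>* q0 q"
  by (induction rule: reduced.induct) (auto simp: swap_step_def intro: rtranclp.rtrancl_into_rtrancl)

lemma swap_steps_reduced:
  assumes "swap_step\<^sup>*\<^sup>* q0 q" shows "\<exists>j. reduced q0 q j"
  using assms
proof (induction rule: rtranclp_induct)
  case base
  show ?case using reduced.empty by blast
next
  case (step q q')
  then obtain i j where i: "i < 4" "q' = swap i q" and r: "reduced q0 q j"
    by (auto simp: swap_step_def)
  show ?case
  proof (cases "i = j")
    case False
    then show ?thesis using i r reduced.snoc by blast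
  next
    case True
    from r show ?thesis
    proof cases
      case empty
      then show ?thesis using True i by simp
    next
      case (snoc q1 j1)
      then show ?thesis using True i by (auto simp: swap_swap)
    qed
  qed
qed

text \<open>Once \<open>x\<close> has been swapped out, the most recently created vector is always the farthest
  from \<open>x\<close>, so the next swap, which replaces another vector, moves even farther away.\<close>

lemma reduced_growth:
  assumes "reduced q0 q j" "descartes q0" "x \<in> q0 ` {..<4}"
  shows "x \<in> q ` {..<4} \<or>
    (j < 4 \<and> lor x (q j) \<le> -7 \<and> (\<forall>i<4. lor x (q i) \<le> -1 \<and> lor x (q j) \<le> lor x (q i)))"
  using assms(1)
proof (induction rule: reduced.induct)
  case empty
  then show ?case using assms by simp
next
  case (snoc q j i)
  have q: "descartes q"
    using snoc assms descartes_swap_steps reduced_swap_steps by blast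
  from snoc.IH show ?case
  proof
    assume "x \<in> q ` {..<4}"
    then obtain k where k: "k < 4" "x = q k" by auto
    show ?thesis
    proof (cases "k = i")
      case False
      then have "x = swap i q k" using k by (simp add: swap_def)
      then show ?thesis using k by blast
    next
      case True
      have "lor x (swap i q i) = -7"
        using q k True by (simp add: lor_swap descartes_sum) (simp add: descartes_def)
      moreover have "lor x (swap i q l) = -1" if "l < 4" "l \<noteq> i" for l
        using q k True that by (simp add: descartes_def swap_def)
      ultimately have "\<forall>l<4. lor x (swap i q l) \<le> -1 \<and> -7 \<le> lor x (swap i q l)"
        by force
      then show ?thesis
        using snoc.hyps \<open>lor x (swap i q i) = -7\<close> by simp
    qed
  next
    assume *: "j < 4 \<and> lor x (q j) \<le> -7 \<and>
      (\<forall>i<4. lor x (q i) \<le> -1 \<and> lor x (q j) \<le> lor x (q i))"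
    have "(\<Sum>l\<in>{..<4} - {i}. lor x (q l)) = lor x (q j) + (\<Sum>l\<in>{..<4} - {i} - {j}. lor x (q l))"
      using * snoc.hyps by (simp add: sum.remove[of _ j])
    moreover have "(\<Sum>l\<in>{..<4} - {i} - {j}. lor x (q l)) \<le> (\<Sum>l\<in>{..<4} - {i} - {j}. - 1)"
      using * by (intro sum_mono) auto
    moreover have "card ({..<4} - {i} - {j}) = 2" using * snoc.hyps by simp
    moreover have "lor x (q j) \<le> lor x (q i)" using * snoc.hyps by simp
    ultimately have "lor x (swap i q i) \<le> lor x (q j) - 4"
      by (simp add: lor_swap)
    then have "lor x (swap i q i) \<le> lor x (swap i q l) \<and> lor x (swap i q l) \<le> -1" if "l < 4" for l
      using * that by (cases "l = i") (auto simp: swap_other intro: order_trans)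
    moreover have "lor x (swap i q i) \<le> -7"
      using * \<open>lor x (swap i q i) \<le> lor x (q j) - 4\<close> by simp
    ultimately show ?thesis using snoc.hyps by simp
  qed
qed

lemma swap_steps_separated:
  assumes "descartes q" "swap_step\<^sup>*\<^sup>* q q'" "x \<in> q ` {..<4}" "y \<in> q' ` {..<4}"
  shows "x = y \<or> lor x y \<le> -1"
proof -
  obtain j where j: "reduced q q' j" using assms swap_steps_reduced by blast
  have "descartes q'" using assms descartes_swap_steps by blast
  then have "x \<in> q' ` {..<4} \<Longrightarrow> ?thesis"
    using assms(4) unfolding descartes_def by (smt (verit) imageE lessThan_iff)
  then show ?thesis using reduced_growth[OF j assms(1,3)] assms(4) by auto
qed

lemma reduced_common_quadruple:
  assumes "reduced q0 q j" "descartes q0" "z \<in> q ` {..<4}"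
  shows "\<exists>q'. swap_step\<^sup>*\<^sup>* q0 q' \<and> z \<in> q' ` {..<4} \<and>
    (\<forall>x \<in> q0 ` {..<4}. lor x z = -1 \<longrightarrow> x \<in> q' ` {..<4})"
  using assms(1,3)
proof (induction rule: reduced.induct)
  case empty
  then show ?case by blast
next
  case (snoc q j i)
  have r: "reduced q0 (swap i q) i" using snoc.hyps reduced.snoc by blast
  obtain l where l: "l < 4" "z = swap i q l" using snoc.prems by auto
  show ?case
  proof (cases "l = i")
    case False
    then have "z \<in> q ` {..<4}" using l by (simp add: swap_def)
    then show ?thesis using snoc.IH by blast
  next
    case True
    have "x \<in> swap i q ` {..<4}" if "x \<in> q0 ` {..<4}" "lor x z = -1" for x
      using reduced_growth[OF r assms(2) that(1)] that(2) l True by auto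
    then show ?thesis using reduced_swap_steps[OF r] snoc.prems by blast
  qed
qed

lemma swap_steps_fourth_vector:
  assumes q: "descartes q" and x: "x \<in> q ` {..<4}" and y: "y \<in> q ` {..<4}" and z: "z \<in> q ` {..<4}"
    and xyz: "lor x y = -1" "lor x z = -1" "lor y z = -1"
    and w: "lor w w = 1" "lor w x = -1" "lor w y = -1" "lor w z = -1"
  shows "\<exists>q'. swap_step\<^sup>*\<^sup>* q q' \<and> w \<in> q' ` {..<4}"
proof -
  obtain i j k where i: "i < 4" "x = q i" and j: "j < 4" "y = q j" and k: "k < 4" "z = q k"
    using x y z by auto
  have ij: "i \<noteq> j" "i \<noteq> k" "j \<noteq> k" using q i j k xyz by (auto simp: descartes_def)
  have "card {i, j, k} = 3" using ij by simp
  have "card ({..<4::nat} - {i, j, k}) = 1"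
    using i j k ij by (subst card_Diff_subset) auto
  then have "{..<4::nat} - {i, j, k} \<noteq> {}" by (metis card.empty zero_neq_one)
  then obtain l where l: "l < 4" "l \<noteq> i" "l \<noteq> j" "l \<noteq> k" by auto
  have "{i, j, k} = {..<4} - {l}"
    by (rule card_subset_eq) (use i j k l ij in auto)
  then have s: "(\<Sum>m\<in>{..<4} - {l}. q m) = x + y + z"
    using i j k ij by (simp add: add.assoc flip: \<open>{i, j, k} = {..<4} - {l}\<close>)
  have "w = q l \<or> w = 2 *\<^sub>R (x + y + z) - q l"
    by (rule two_fourth_vectors) (use q i j k l ij w in \<open>auto simp: descartes_def\<close>)
  moreover have "swap l q l = 2 *\<^sub>R (x + y + z) - q l"
    unfolding swap_def s by simp
  ultimately show ?thesis using l
    by (metis imageI lessThan_iff r_into_rtranclp rtranclp.rtrancl_refl swap_step_def)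
qed

section \<open>Disks as unit vectors\<close>

fun dvec :: "gdisk \<Rightarrow> lorentz" where
  "dvec (Round_Disk c r) = (1 / r, c /\<^sub>R r, (c \<bullet> c - r\<^sup>2) / r)"
| "dvec (Outer_Disk c r) = (- 1 / r, - c /\<^sub>R r, (r\<^sup>2 - c \<bullet> c) / r)"
| "dvec (Half_Plane e t) = (0, - e, - 2 * t)"

definition lift :: "complex \<Rightarrow> lorentz" where
  "lift p = (1, p, p \<bullet> p)"

definition normal :: "lorentz \<Rightarrow> complex \<Rightarrow> complex" where
  "normal v p = fst v *\<^sub>R p - fst (snd v)"

lemma fst_vec [simp]: "fst (dvec D) = curvature D"
  by (cases D) auto

lemma curvature_eq_0_iff: "is_disk D \<Longrightarrow> curvature D = 0 \<longleftrightarrow> is_half_plane D"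
  by (cases D) auto

lemma lor_vec_self: "is_disk D \<Longrightarrow> lor (dvec D) (dvec D) = 1"
  by (cases D) (auto simp: lor_def field_simps power2_eq_square norm_eq_1)

lemma dvec_inject:
  assumes "is_disk D" "is_disk E" "dvec D = dvec E" shows "D = E"
proof -
  have "curvature D = curvature E" using assms by (metis fst_vec)
  then show ?thesis using assms
    by (cases D; cases E) (auto simp: divide_simps)
qed

lemma dvec_surject:
  assumes "lor v v = 1" shows "\<exists>D. is_disk D \<and> dvec D = v"
proof -
  obtain A w C where v: "v = (A, w, C)" by (metis prod.exhaust)
  have ww: "w \<bullet> w = 1 + A * C" using assms v by (simp add: lor_def)
  consider "A > 0" | "A < 0" | "A = 0" by linarith
  then show ?thesis
  proof cases
    case 1
    then have "dvec (Round_Disk (w /\<^sub>R A) (1 / A)) = v"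
      using ww by (simp add: v field_simps power2_eq_square)
    then show ?thesis using 1 by (metis divide_pos_pos is_disk.simps(1) zero_less_one)
  next
    case 2
    then have "dvec (Outer_Disk (w /\<^sub>R A) (- 1 / A)) = v"
      using ww by (simp add: v field_simps power2_eq_square)
    moreover have "is_disk (Outer_Disk (w /\<^sub>R A) (- 1 / A))" using 2 by (simp add: divide_simps)
    ultimately show ?thesis by blast
  next
    case 3
    then have "dvec (Half_Plane (- w) (- C / 2)) = v" by (simp add: v)
    moreover have "is_disk (Half_Plane (- w) (- C / 2))" using 3 ww by (simp add: norm_eq_1)
    ultimately show ?thesis by blast
  qed
qed

lemma lor_lift_round:
  assumes "r > 0"
  shows "lor (dvec (Round_Disk c r)) (lift p) = (r\<^sup>2 - (dist c p)\<^sup>2) / (2 * r)"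
    and "lor (dvec (Outer_Disk c r)) (lift p) = ((dist c p)\<^sup>2 - r\<^sup>2) / (2 * r)"
proof -
  have d: "(dist c p)\<^sup>2 = c \<bullet> c + p \<bullet> p - 2 * (c \<bullet> p)"
    by (simp add: dist_norm power2_norm_eq_inner inner_diff inner_commute)
  show "lor (dvec (Round_Disk c r)) (lift p) = (r\<^sup>2 - (dist c p)\<^sup>2) / (2 * r)"
    and "lor (dvec (Outer_Disk c r)) (lift p) = ((dist c p)\<^sup>2 - r\<^sup>2) / (2 * r)"
    unfolding d using assms by (simp_all add: lor_def lift_def field_simps power2_eq_square)
qed

lemma region_iff:
  assumes "is_disk D" shows "p \<in> region D \<longleftrightarrow> lor (dvec D) (lift p) \<ge> 0"
  using assms lor_lift_round
  by (cases D) (auto simp: lor_def lift_def zero_le_divide_iff abs_le_square_iff[symmetric] not_less)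

lemma interior_region_iff:
  assumes "is_disk D" shows "p \<in> interior (region D) \<longleftrightarrow> lor (dvec D) (lift p) > 0"
proof -
  have "e \<noteq> 0" if "norm e = 1" for e :: complex using that by auto
  moreover have "s\<^sup>2 < r\<^sup>2 \<longleftrightarrow> s < r" if "r \<ge> 0" "s \<ge> 0" for r s :: real
    using that by (metis less_eq_real_def power_less_imp_less_base power_strict_mono zero_less_numeral)
  ultimately show ?thesis using assms lor_lift_round
    by (cases D) (auto simp: lor_def lift_def zero_less_divide_iff interior_complement not_le)
qed

lemma lor_lift_add:
  "lor v (lift (p + y)) = lor v (lift p) - normal v p \<bullet> y - fst v * (y \<bullet> y) / 2"
  by (simp add: lor_def lift_def normal_def inner_simps inner_commute field_simps)

lemma normal_inner_self:
  "lor v v = 1 \<Longrightarrow> normal v p \<bullet> normal v p = 1 - 2 * fst v * lor v (lift p)"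
  by (simp add: lor_def lift_def normal_def inner_simps inner_commute algebra_simps)

lemma eventually_quadratic_pos:
  fixes q \<alpha> \<beta> :: real
  assumes "q > 0 \<or> q = 0 \<and> \<alpha> > 0"
  shows "\<forall>\<^sub>F s in at_right 0. q + \<alpha> * s + \<beta> * s\<^sup>2 > 0"
proof (cases "q > 0")
  case True
  have "((\<lambda>s. q + \<alpha> * s + \<beta> * s\<^sup>2) \<longlongrightarrow> q + \<alpha> * 0 + \<beta> * 0\<^sup>2) (at_right 0)"
    by (intro tendsto_intros)
  then show ?thesis using True by (intro order_tendstoD) auto
next
  case False
  have "((\<lambda>s. \<alpha> + \<beta> * s) \<longlongrightarrow> \<alpha> + \<beta> * 0) (at_right 0)"
    by (intro tendsto_intros)
  then have "\<forall>\<^sub>F s in at_right 0. \<alpha> + \<beta> * s > 0"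
    using assms False by (intro order_tendstoD) auto
  moreover have "\<forall>\<^sub>F s in at_right (0::real). s > 0"
    by (simp add: eventually_at_right_less)
  ultimately show ?thesis
  proof eventually_elim
    case (elim s)
    then have "s * (\<alpha> + \<beta> * s) > 0" by simp
    then show ?case using assms False by (simp add: algebra_simps power2_eq_square)
  qed
qed

definition touching :: "lorentz \<Rightarrow> lorentz \<Rightarrow> bool" where
  "touching x y \<longleftrightarrow> lor x y = -1 \<and>
     (fst x + fst y > 0 \<or> fst x = 0 \<and> fst y = 0 \<and> snd (snd x) + snd (snd y) \<ge> 0)"

lemma touching_commute: "touching x y \<longleftrightarrow> touching y x"
  by (auto simp: touching_def lor_commute add.commute)

lemma separated_boundary:
  assumes x: "lor x x = 1" and y: "lor y y = 1"
    and disj: "\<And>q. \<not> (lor x (lift q) > 0 \<and> lor y (lift q) > 0)"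
    and p: "lor x (lift p) \<ge> 0" "lor y (lift p) \<ge> 0"
  shows "lor x (lift p) = 0"
proof (rule ccontr)
  assume "lor x (lift p) \<noteq> 0"
  then have xp: "lor x (lift p) > 0" using p by simp
  then have yp: "lor y (lift p) = 0" using disj p by (metis less_eq_real_def)
  define f where "f = normal y p"
  have ff: "f \<bullet> f = 1" using normal_inner_self[OF y] yp by (simp add: f_def)
  have e: "lor v (lift (p + (- s) *\<^sub>R f)) =
      lor v (lift p) + (normal v p \<bullet> f) * s + (- fst v / 2) * s\<^sup>2" for v s
    by (simp only: lor_lift_add) (simp add: ff power2_eq_square)
  have "\<forall>\<^sub>F s in at_right 0. lor x (lift (p + (- s) *\<^sub>R f)) > 0"
    unfolding e by (rule eventually_quadratic_pos) (use xp in simp)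
  moreover have "\<forall>\<^sub>F s in at_right 0. lor y (lift (p + (- s) *\<^sub>R f)) > 0"
    unfolding e by (rule eventually_quadratic_pos) (use yp ff in \<open>simp add: f_def\<close>)
  ultimately have "\<forall>\<^sub>F s in at_right (0::real). False"
    by eventually_elim (use disj in blast)
  then show False by simp
qed

lemma touching_if_single_point:
  assumes x: "lor x x = 1" and y: "lor y y = 1"
    and disj: "\<And>q. \<not> (lor x (lift q) > 0 \<and> lor y (lift q) > 0)"
    and p: "\<And>q. lor x (lift q) \<ge> 0 \<and> lor y (lift q) \<ge> 0 \<longleftrightarrow> q = p"
  shows "touching x y"
proof -
  have xp: "lor x (lift p) = 0" and yp: "lor y (lift p) = 0"
    using separated_boundary[OF x y disj] separated_boundary[OF y x] disj p by blast+
  define e f where "e = normal x p" and "f = normal y p"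
  have ee: "e \<bullet> e = 1" and ff: "f \<bullet> f = 1"
    using normal_inner_self[OF x] normal_inner_self[OF y] xp yp by (simp_all add: e_def f_def)
  have "f = - e"
  proof (rule ccontr)
    assume "f \<noteq> - e"
    then have "(e + f) \<bullet> (e + f) > 0"
      by (metis inner_gt_zero_iff add.commute eq_neg_iff_add_eq_0)
    then have pos: "e \<bullet> (e + f) > 0" "f \<bullet> (e + f) > 0"
      using ee ff by (simp_all add: inner_simps inner_commute)
    have ex: "lor v (lift (p + (- s) *\<^sub>R (e + f))) =
      lor v (lift p) + (normal v p \<bullet> (e + f)) * s + (- fst v * ((e + f) \<bullet> (e + f)) / 2) * s\<^sup>2" for v s
      by (simp only: lor_lift_add) (simp add: power2_eq_square)
    have "\<forall>\<^sub>F s in at_right 0. lor x (lift (p + (- s) *\<^sub>R (e + f))) > 0"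
      unfolding ex by (rule eventually_quadratic_pos) (use xp pos in \<open>simp add: e_def\<close>)
    moreover have "\<forall>\<^sub>F s in at_right 0. lor y (lift (p + (- s) *\<^sub>R (e + f))) > 0"
      unfolding ex by (rule eventually_quadratic_pos) (use yp pos in \<open>simp add: f_def\<close>)
    ultimately have "\<forall>\<^sub>F s in at_right (0::real). False"
      by eventually_elim (use disj in blast)
    then show False by simp
  qed
  have "fst x + fst y > 0"
  proof (rule ccontr)
    assume neg: "\<not> fst x + fst y > 0"
    define \<kappa> where "\<kappa> = (fst y - fst x) / 2"
    have "\<exists>v. v \<noteq> 0 \<and> e \<bullet> v = \<kappa> * (v \<bullet> v) / 2"
    proof (cases "\<kappa> = 0")
      case True
      have "\<i> * e \<noteq> 0" using ee by auto
      moreover have "e \<bullet> (\<i> * e) = 0" by (simp add: inner_complex_def)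
      ultimately have "\<i> * e \<noteq> 0 \<and> e \<bullet> (\<i> * e) = \<kappa> * ((\<i> * e) \<bullet> (\<i> * e)) / 2"
        using True by simp
      then show ?thesis by blast
    next
      case False
      then have "(2 / \<kappa>) *\<^sub>R e \<noteq> 0" using ee by auto
      moreover have "e \<bullet> ((2 / \<kappa>) *\<^sub>R e) = \<kappa> * (((2 / \<kappa>) *\<^sub>R e) \<bullet> ((2 / \<kappa>) *\<^sub>R e)) / 2"
        using False by (simp add: ee)
      ultimately show ?thesis by blast
    qed
    then obtain v where v: "v \<noteq> 0" "e \<bullet> v = \<kappa> * (v \<bullet> v) / 2" by blast
    have "(fst x + fst y) * (v \<bullet> v) \<le> 0" using neg by (simp add: mult_nonpos_nonneg)
    moreover have "lor x (lift (p + v)) = - ((fst x + fst y) * (v \<bullet> v)) / 4"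
      using v(2) by (simp add: lor_lift_add xp flip: e_def) (simp add: \<kappa>_def field_simps)
    moreover have "lor y (lift (p + v)) = - ((fst x + fst y) * (v \<bullet> v)) / 4"
      using v(2) by (simp add: lor_lift_add yp \<open>f = - e\<close> flip: f_def) (simp add: \<kappa>_def field_simps)
    ultimately have "p + v = p" using p[of "p + v"] by simp
    then show False using v by simp
  qed
  moreover have "lor x y = -1"
  proof -
    have w: "fst (snd x) = fst x *\<^sub>R p - e" "fst (snd y) = fst y *\<^sub>R p + e"
      using \<open>f = - e\<close> by (simp_all add: e_def f_def normal_def algebra_simps)
    have C: "snd (snd x) = fst x * (p \<bullet> p) - 2 * (e \<bullet> p)" "snd (snd y) = fst y * (p \<bullet> p) + 2 * (e \<bullet> p)"
      using xp yp by (simp_all add: lor_def lift_def w inner_simps)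
    show ?thesis unfolding lor_def w C
      by (simp add: inner_simps ee inner_commute field_simps)
  qed
  ultimately show ?thesis by (simp add: touching_def)
qed

lemma tangency_point:
  assumes x: "lor x x = 1" and y: "lor y y = 1" and t: "lor x y = -1"
  shows "(norm ((fst x + fst y) *\<^sub>R p - (fst (snd x) + fst (snd y))))\<^sup>2
    = - 2 * (fst x + fst y) * (lor x (lift p) + lor y (lift p))"
proof -
  define a z c where "a = fst x + fst y" and "z = fst (snd x) + fst (snd y)"
    and "c = snd (snd x) + snd (snd y)"
  have "lor (x + y) (x + y) = 0" using assms by (simp add: lor_commute)
  then have zz: "z \<bullet> z = a * c"
    by (simp only: lor_def) (simp add: a_def z_def c_def)
  have l: "lor x (lift p) + lor y (lift p) = z \<bullet> p - (a * (p \<bullet> p) + c) / 2"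
    by (simp add: lor_def lift_def a_def z_def c_def inner_simps field_simps)
  have "(norm (a *\<^sub>R p - z))\<^sup>2 = - 2 * a * (lor x (lift p) + lor y (lift p))"
    unfolding l power2_norm_eq_inner
    by (simp add: inner_diff_left inner_diff_right inner_commute zz field_simps)
  then show ?thesis by (simp add: a_def z_def)
qed

lemma half_planes_touching:
  assumes e: "norm e = 1" "norm f = 1"
    and disj: "\<And>q. \<not> (e \<bullet> q < t \<and> f \<bullet> q < s)"
  shows "f = - e \<and> t + s \<le> 0"
proof -
  have ee: "e \<bullet> e = 1" "f \<bullet> f = 1" using e by (simp_all add: norm_eq_1)
  have "f = - e"
  proof (rule ccontr)
    assume "f \<noteq> - e"
    then have "(e + f) \<bullet> (e + f) > 0"
      by (metis inner_gt_zero_iff add.commute eq_neg_iff_add_eq_0)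
    then have pos: "1 + e \<bullet> f > 0"
      using ee by (simp add: inner_simps inner_commute)
    define r where "r = (\<bar>t\<bar> + \<bar>s\<bar> + 1) / (1 + e \<bullet> f)"
    have "r * (1 + e \<bullet> f) = \<bar>t\<bar> + \<bar>s\<bar> + 1" using pos by (simp add: r_def)
    then have "e \<bullet> (- r *\<^sub>R (e + f)) < t" "f \<bullet> (- r *\<^sub>R (e + f)) < s"
      using ee by (auto simp: inner_simps inner_commute algebra_simps)
    then show False using disj by blast
  qed
  moreover have "t + s \<le> 0"
    using disj[of "((t - s) / 2) *\<^sub>R e"] \<open>f = - e\<close> by (simp add: ee field_simps)
  ultimately show ?thesis by simp
qed

lemma tangent_iff_touching:
  assumes D: "is_disk D" and E: "is_disk E"
  shows "tangent D E \<longleftrightarrow> touching (dvec D) (dvec E)"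
proof
  have dd: "lor (dvec D) (dvec D) = 1" and ee: "lor (dvec E) (dvec E) = 1"
    using D E by (simp_all add: lor_vec_self)
  {
    assume t: "tangent D E"
    then have disj: "\<not> (lor (dvec D) (lift q) > 0 \<and> lor (dvec E) (lift q) > 0)" for q
      using interior_region_iff[OF D] interior_region_iff[OF E] unfolding tangent_def by blast
    show "touching (dvec D) (dvec E)"
    proof (cases "is_half_plane D \<and> is_half_plane E")
      case True
      then obtain e t f s where DE: "D = Half_Plane e t" "E = Half_Plane f s"
        by (meson is_half_plane.elims)
      have "f = - e \<and> t + s \<le> 0"
        by (rule half_planes_touching) (use D E disj in \<open>auto simp: DE lor_def lift_def\<close>)
      then show ?thesis using D by (auto simp: DE touching_def lor_def norm_eq_1)
    next
      case False
      then obtain p where "region D \<inter> region E = {p}" using t unfolding tangent_def by blast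
      then have "lor (dvec D) (lift q) \<ge> 0 \<and> lor (dvec E) (lift q) \<ge> 0 \<longleftrightarrow> q = p" for q
        using region_iff[OF D] region_iff[OF E] by blast
      then show ?thesis using touching_if_single_point[OF dd ee disj] by blast
    qed
  next
    assume t: "touching (dvec D) (dvec E)"
    then have l: "lor (dvec D) (dvec E) = -1" by (simp add: touching_def)
    define a where "a = fst (dvec D) + fst (dvec E)"
    define z where "z = fst (snd (dvec D)) + fst (snd (dvec E))"
    have nz: "(norm (a *\<^sub>R p - z))\<^sup>2 = - 2 * a * (lor (dvec D) (lift p) + lor (dvec E) (lift p))" for p
      using tangency_point[OF dd ee l] by (simp add: a_def z_def)
    have "interior (region D) \<inter> interior (region E) = {} \<and>
      ((\<exists>p. region D \<inter> region E = {p}) \<or> is_half_plane D \<and> is_half_plane E)"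
    proof (cases "a > 0")
      case True
      have sum: "lor (dvec D) (lift p) + lor (dvec E) (lift p) \<le> 0" for p
        using nz[of p] True zero_le_power2[of "norm (a *\<^sub>R p - z)"]
        by (simp add: mult_le_0_iff)
      have both: "lor (dvec D) (lift p) \<ge> 0 \<and> lor (dvec E) (lift p) \<ge> 0 \<longleftrightarrow> p = z /\<^sub>R a" for p
      proof
        assume "lor (dvec D) (lift p) \<ge> 0 \<and> lor (dvec E) (lift p) \<ge> 0"
        then have "lor (dvec D) (lift p) + lor (dvec E) (lift p) = 0" using sum[of p] by simp
        then have "a *\<^sub>R p = z" using nz[of p] by simp
        then show "p = z /\<^sub>R a" using True by auto
      next
        assume p: "p = z /\<^sub>R a"
        define v where "v = dvec D + dvec E"
        have vv: "lor v v = 0" "lor v (dvec D) = 0" "lor v (dvec E) = 0"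
          using dd ee l by (simp_all add: v_def lor_commute)
        have "z \<bullet> z = a * snd (snd v)"
          using vv(1) unfolding lor_def by (simp add: v_def a_def z_def)
        then have "lift p = (1 / a) *\<^sub>R v"
          using True by (simp add: lift_def prod_eq_iff p v_def a_def z_def divide_simps)
        then show "lor (dvec D) (lift p) \<ge> 0 \<and> lor (dvec E) (lift p) \<ge> 0"
          using vv by (simp add: lor_commute)
      qed
      have "region D \<inter> region E = {z /\<^sub>R a}"
        using both region_iff[OF D] region_iff[OF E] by blast
      moreover have "interior (region D) \<inter> interior (region E) = {}"
        using sum interior_region_iff[OF D] interior_region_iff[OF E]
        by (auto simp: disjoint_iff) (smt (verit))
      ultimately show ?thesis by blast
    next
      case False
      then have h: "fst (dvec D) = 0" "fst (dvec E) = 0" "snd (snd (dvec D)) + snd (snd (dvec E)) \<ge> 0"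
        using t by (auto simp: touching_def a_def)
      then have hp: "is_half_plane D \<and> is_half_plane E"
        using D E by (simp add: curvature_eq_0_iff)
      have "z = 0" using nz[of 0] False h by (simp add: a_def)
      have "lor (dvec D) (lift p) + lor (dvec E) (lift p) \<le> 0" for p
      proof -
        have "lor (dvec D) (lift p) + lor (dvec E) (lift p)
            = z \<bullet> p - (snd (snd (dvec D)) + snd (snd (dvec E))) / 2"
          using h by (simp add: lor_def lift_def z_def inner_add_left field_simps)
        then show ?thesis using h \<open>z = 0\<close> by simp
      qed
      then have "interior (region D) \<inter> interior (region E) = {}"
        using interior_region_iff[OF D] interior_region_iff[OF E]
        by (auto simp: disjoint_iff) (smt (verit))
      then show ?thesis using hp by blast
    qed
    then show "tangent D E" unfolding tangent_def by blast
  }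
qed

lemma tangency_spinor_square:
  assumes D: "is_disk D" and E: "is_disk E" and t: "tangent D E"
    and u: "tangency_spinor D E u"
  shows "u\<^sup>2 = curvature D *\<^sub>R fst (snd (dvec E)) - curvature E *\<^sub>R fst (snd (dvec D))"
proof -
  have dd: "lor (dvec D) (dvec D) = 1" and ee: "lor (dvec E) (dvec E) = 1"
    and l: "lor (dvec D) (dvec E) = -1"
    using D E t by (simp_all add: lor_vec_self tangent_iff_touching touching_def)
  have c: "fst (snd (dvec X)) = curvature X *\<^sub>R center X" if "\<not> is_half_plane X" for X
    using that by (cases X) (auto simp: divide_inverse)
  have n: "outward_normal X p = normal (dvec X) p" if "is_disk X" for X p
    using that by (cases X) (auto simp: normal_def scaleR_conv_of_real field_simps)
  show ?thesis
  proof (cases "is_half_plane D = is_half_plane E")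
    case True
    then show ?thesis
      using u D E curvature_eq_0_iff[of D] curvature_eq_0_iff[of E] c[of D] c[of E]
      by (auto simp: tangency_spinor_def scaleR_conv_of_real algebra_simps)
  next
    case False
    then obtain p where p: "p \<in> region D" "p \<in> region E"
      and up: "u\<^sup>2 = of_real (curvature D + curvature E) * outward_normal D p"
      using u unfolding tangency_spinor_def by auto
    have pos: "curvature D + curvature E > 0"
      using D E t False by (auto simp: tangent_iff_touching touching_def curvature_eq_0_iff)
    have "lor (dvec D) (lift p) + lor (dvec E) (lift p) \<ge> 0"
      using p region_iff D E by simp
    then have "(curvature D + curvature E) * (lor (dvec D) (lift p) + lor (dvec E) (lift p)) \<ge> 0"
      using pos by simp
    then have "(norm ((curvature D + curvature E) *\<^sub>R p - (fst (snd (dvec D)) + fst (snd (dvec E)))))\<^sup>2 \<le> 0"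
      using tangency_point[OF dd ee l, of p] unfolding fst_vec mult.assoc by linarith
    then have "(curvature D + curvature E) *\<^sub>R p = fst (snd (dvec D)) + fst (snd (dvec E))"
      by simp
    then have eq: "fst (snd (dvec E)) = (curvature D + curvature E) *\<^sub>R p - fst (snd (dvec D))"
      by (simp add: algebra_simps)
    show ?thesis
      unfolding up n[OF D] normal_def eq
      using False D E curvature_eq_0_iff[of D] curvature_eq_0_iff[of E]
      by (auto simp: scaleR_conv_of_real algebra_simps)
  qed
qed

section \<open>Separation and spinor coordinates in a packing\<close>

definition future :: "lorentz \<Rightarrow> bool" where
  "future v \<longleftrightarrow> fst v \<ge> 0 \<and> snd (snd v) \<ge> 0"

lemma null_vector: "lor v v = 0 \<Longrightarrow> fst (snd v) \<bullet> fst (snd v) = fst v * snd (snd v)"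
  by (simp add: lor_def)

lemma future_transfer:
  assumes u: "lor u u = 0" "future u" and v: "lor v v = 0" and uv: "lor u v < 0"
  shows "future v"
proof -
  obtain a z c where uu: "u = (a, z, c)" by (metis prod.exhaust)
  obtain A w C where vv: "v = (A, w, C)" by (metis prod.exhaust)
  have zz: "z \<bullet> z = a * c" and ww: "w \<bullet> w = A * C"
    using null_vector[OF u(1)] null_vector[OF v] by (simp_all add: uu vv)
  have ac: "a \<ge> 0" "c \<ge> 0" using u(2) by (simp_all add: future_def uu)
  have AC: "A * C \<ge> 0" using ww inner_ge_zero[of w] by simp
  have "\<not> (A \<le> 0 \<and> C \<le> 0)"
  proof
    assume neg: "A \<le> 0 \<and> C \<le> 0"
    have "(z \<bullet> w)\<^sup>2 \<le> (a * c) * (A * C)" using Cauchy_Schwarz_ineq[of z w] zz ww by simp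
    moreover have "4 * ((a * c) * (A * C)) \<le> (a * (- C) + (- A) * c)\<^sup>2"
    proof -
      have "(a * (- C) + (- A) * c)\<^sup>2 = (a * C - A * c)\<^sup>2 + 4 * ((a * c) * (A * C))" by algebra
      then show ?thesis by simp
    qed
    ultimately have "(2 * (z \<bullet> w))\<^sup>2 \<le> (a * (- C) + (- A) * c)\<^sup>2"
      by (simp add: power_mult_distrib)
    moreover have "0 \<le> a * (- C) + (- A) * c"
      using neg ac by (intro add_nonneg_nonneg mult_nonneg_nonneg) auto
    ultimately have "\<bar>2 * (z \<bullet> w)\<bar> \<le> a * (- C) + (- A) * c"
      by (metis abs_le_square_iff abs_of_nonneg)
    then show False using uv by (simp add: uu vv lor_def)
  qed
  then show ?thesis using AC by (auto simp: future_def vv zero_le_mult_iff)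
qed

lemma touching_imp_future:
  assumes "lor x x = 1" "lor y y = 1" "touching x y" shows "future (x + y)"
proof -
  have "lor (x + y) (x + y) = 0" using assms by (simp add: touching_def lor_commute)
  then have "(fst x + fst y) * (snd (snd x) + snd (snd y)) \<ge> 0"
    using null_vector[of "x + y"] inner_ge_zero[of "fst (snd (x + y))"] by simp
  then show ?thesis using assms
    by (auto simp: touching_def future_def zero_le_mult_iff)
qed

lemma future_imp_touching:
  assumes x: "lor x x = 1" and y: "lor y y = 1" and l: "lor x y = -1"
    and f: "future (x + y)" and nz: "x + y \<noteq> 0"
  shows "touching x y"
proof (cases "fst x + fst y > 0")
  case True
  then show ?thesis using l by (simp add: touching_def)
next
  case False
  then have a: "fst y = - fst x" using f by (simp add: future_def)
  have "lor (x + y) (x + y) = 0" using assms by (simp add: lor_commute)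
  then have "fst (snd (x + y)) = 0" using null_vector[of "x + y"] a by simp
  then have w: "fst (snd y) = - fst (snd x)" by (simp add: eq_neg_iff_add_eq_0 add.commute)
  have "fst x * (snd (snd x) + snd (snd y)) = 0"
    using x l by (simp add: lor_def a w field_simps)
  moreover have "snd (snd x) + snd (snd y) \<noteq> 0"
    using nz a w by (auto simp: prod_eq_iff)
  ultimately have "fst x = 0" by simp
  then show ?thesis using l f a by (simp add: touching_def future_def)
qed

lemma swap_steps_common_quadruple:
  assumes q0: "descartes q0" and q1: "swap_step\<^sup>*\<^sup>* q0 q1"
    and q2: "swap_step\<^sup>*\<^sup>* q0 q2" "z \<in> q2 ` {..<4}"
  shows "\<exists>q. swap_step\<^sup>*\<^sup>* q0 q \<and> z \<in> q ` {..<4} \<and>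
    (\<forall>x \<in> q1 ` {..<4}. lor x z = -1 \<longrightarrow> x \<in> q ` {..<4})"
proof -
  have "swap_step\<^sup>*\<^sup>* q1 q2" using swap_steps_sym[OF q1] q2(1) by (rule rtranclp_trans)
  then obtain j where "reduced q1 q2 j" using swap_steps_reduced by blast
  from reduced_common_quadruple[OF this descartes_swap_steps[OF q1 q0] q2(2)]
  show ?thesis using rtranclp_trans[OF q1] by metis
qed

lemma packing_in_swap_orbit:
  assumes D: "is_disk D1" "is_disk D2" "is_disk D3" and m: "mutually_tangent D1 D2 D3"
  obtains q0 where "descartes q0"
    "\<And>X. X \<in> packing D1 D2 D3 \<Longrightarrow> is_disk X \<and> (\<exists>q. swap_step\<^sup>*\<^sup>* q0 q \<and> dvec X \<in> q ` {..<4})"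
proof -
  have u: "lor (dvec D1) (dvec D1) = 1" "lor (dvec D2) (dvec D2) = 1" "lor (dvec D3) (dvec D3) = 1"
    using D by (simp_all add: lor_vec_self)
  have l: "lor (dvec D1) (dvec D2) = -1" "lor (dvec D1) (dvec D3) = -1" "lor (dvec D2) (dvec D3) = -1"
    using m D by (auto simp: mutually_tangent_def tangent_iff_touching touching_def)
  obtain k where k: "lor k k = 1" "lor k (dvec D1) = 0" "lor k (dvec D2) = 0" "lor k (dvec D3) = 0"
    by (rule orthonormal_frame[OF u l])
  define q0 where "q0 = (\<lambda>i::nat. if i = 0 then dvec D1 else if i = 1 then dvec D2 else if i = 2 then dvec D3
      else dvec D1 + dvec D2 + dvec D3 + 2 *\<^sub>R k)"
  have "(i::nat) < 4 \<longleftrightarrow> i = 0 \<or> i = 1 \<or> i = 2 \<or> i = 3" for i by auto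
  moreover have "lor (dvec D2) (dvec D1) = -1" "lor (dvec D3) (dvec D1) = -1" "lor (dvec D3) (dvec D2) = -1"
    "lor (dvec D1) k = 0" "lor (dvec D2) k = 0" "lor (dvec D3) k = 0"
    using l k by (simp_all add: lor_commute)
  ultimately have q0: "descartes q0"
    using u l k unfolding descartes_def q0_def by auto
  have mem: "dvec D1 \<in> q0 ` {..<4}" "dvec D2 \<in> q0 ` {..<4}" "dvec D3 \<in> q0 ` {..<4}"
    by (rule image_eqI[of _ _ 0] image_eqI[of _ _ 1] image_eqI[of _ _ 2]; simp add: q0_def)+
  have "is_disk X \<and> (\<exists>q. swap_step\<^sup>*\<^sup>* q0 q \<and> dvec X \<in> q ` {..<4})"
    if "X \<in> packing D1 D2 D3" for X
    using that
  proof (induction rule: packing.induct)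
    case first
    show ?case using D mem by (intro conjI exI[of _ q0]) simp_all
  next
    case second
    show ?case using D mem by (intro conjI exI[of _ q0]) simp_all
  next
    case third
    show ?case using D mem by (intro conjI exI[of _ q0]) simp_all
  next
    case (adjoin X Y Z W)
    have l: "lor (dvec X) (dvec Y) = -1" "lor (dvec X) (dvec Z) = -1" "lor (dvec Y) (dvec Z) = -1"
      "lor (dvec W) (dvec X) = -1" "lor (dvec W) (dvec Y) = -1" "lor (dvec W) (dvec Z) = -1"
      using adjoin by (auto simp: mutually_tangent_def tangent_iff_touching touching_def)
    obtain qx qy qz where
      qx: "swap_step\<^sup>*\<^sup>* q0 qx" "dvec X \<in> qx ` {..<4}" and
      qy: "swap_step\<^sup>*\<^sup>* q0 qy" "dvec Y \<in> qy ` {..<4}" and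
      qz: "swap_step\<^sup>*\<^sup>* q0 qz" "dvec Z \<in> qz ` {..<4}"
      using adjoin.IH by blast
    obtain q1 where q1: "swap_step\<^sup>*\<^sup>* q0 q1" "dvec Y \<in> q1 ` {..<4}" "dvec X \<in> q1 ` {..<4}"
      using swap_steps_common_quadruple[OF q0 qx(1) qy] qx(2) l(1) by metis
    obtain q2 where q2: "swap_step\<^sup>*\<^sup>* q0 q2" "dvec Z \<in> q2 ` {..<4}" "dvec X \<in> q2 ` {..<4}"
        "dvec Y \<in> q2 ` {..<4}"
      using swap_steps_common_quadruple[OF q0 q1(1) qz] q1(2,3) l(2,3) by metis
    have "descartes q2" using descartes_swap_steps[OF q2(1) q0] .
    then obtain q3 where q3: "swap_step\<^sup>*\<^sup>* q2 q3" "dvec W \<in> q3 ` {..<4}"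
      using swap_steps_fourth_vector[OF _ q2(3,4,2) l(1-3) lor_vec_self[OF \<open>is_disk W\<close>] l(4-6)] by metis
    have "swap_step\<^sup>*\<^sup>* q0 q3" using q2(1) q3(1) by (rule rtranclp_trans)
    then show ?case using q3(2) \<open>is_disk W\<close> by blast
  qed
  then show thesis by (rule that[OF q0])
qed

lemma apollonian_packing_disk:
  assumes "apollonian_packing \<A>" "X \<in> \<A>" shows "is_disk X"
proof -
  obtain D1 D2 D3 where D: "is_disk D1" "is_disk D2" "is_disk D3" "X \<in> packing D1 D2 D3"
    using assms unfolding apollonian_packing_def by blast
  from D(4) show ?thesis by (induction rule: packing.induct) (use D in auto)
qed

lemma apollonian_packing_separated:
  assumes A: "apollonian_packing \<A>" and X: "X \<in> \<A>" and Y: "Y \<in> \<A>"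
  shows "X = Y \<or> lor (dvec X) (dvec Y) \<le> -1"
proof -
  obtain D1 D2 D3 where D: "is_disk D1" "is_disk D2" "is_disk D3" "mutually_tangent D1 D2 D3"
    and eq: "\<A> = packing D1 D2 D3"
    using A unfolding apollonian_packing_def by blast
  obtain q0 where "descartes q0" and
    orb: "\<And>X. X \<in> packing D1 D2 D3 \<Longrightarrow> is_disk X \<and> (\<exists>q. swap_step\<^sup>*\<^sup>* q0 q \<and> dvec X \<in> q ` {..<4})"
    by (rule packing_in_swap_orbit[OF D]) (rule that)
  obtain qx qy where
      qx: "swap_step\<^sup>*\<^sup>* q0 qx" "dvec X \<in> qx ` {..<4}" and
      qy: "swap_step\<^sup>*\<^sup>* q0 qy" "dvec Y \<in> qy ` {..<4}"
    using orb X Y eq by blast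
  have "swap_step\<^sup>*\<^sup>* qx qy" using qx qy by (metis rtranclp_trans swap_steps_sym)
  moreover have "descartes qx" using \<open>descartes q0\<close> descartes_swap_steps qx by blast
  ultimately have "dvec X = dvec Y \<or> lor (dvec X) (dvec Y) \<le> -1"
    using swap_steps_separated qx qy by blast
  then show ?thesis using dvec_inject orb X Y eq by blast
qed

lemma apollonian_packing_adjoin:
  assumes A: "apollonian_packing \<A>" and xyz: "x \<in> dvec ` \<A>" "y \<in> dvec ` \<A>" "z \<in> dvec ` \<A>"
    and w: "lor w w = 1"
    and t: "touching x y" "touching x z" "touching y z" "touching w x" "touching w y" "touching w z"
  shows "w \<in> dvec ` \<A>"
proof -
  obtain D1 D2 D3 where eq: "\<A> = packing D1 D2 D3"
    using A unfolding apollonian_packing_def by blast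
  obtain X Y Z where X: "X \<in> \<A>" "x = dvec X" and Y: "Y \<in> \<A>" "y = dvec Y"
    and Z: "Z \<in> \<A>" "z = dvec Z" using xyz by blast
  obtain W where W: "is_disk W" "dvec W = w" using dvec_surject[OF w] by blast
  have d: "is_disk X" "is_disk Y" "is_disk Z" using apollonian_packing_disk[OF A] X Y Z by auto
  have "W \<in> \<A>" unfolding eq
    by (rule packing.adjoin[of X D1 D2 D3 Y Z W])
       (use X Y Z W t d in \<open>simp_all add: eq mutually_tangent_def tangent_iff_touching\<close>)
  then show ?thesis using W by blast
qed

lemma coprime_approximation:
  fixes s t :: real
  obtains m n :: int where "coprime m n" "\<bar>s * of_int n - t * of_int m\<bar> < 1"
proof (cases "s = 0")
  case True
  then show thesis using that[of 0 1] by simp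
next
  case False
  define N where "N = nat \<lceil>\<bar>s\<bar>\<rceil>"
  have "N > 0" "\<bar>s\<bar> \<le> real N" using False by (auto simp: N_def of_nat_ceiling)
  then obtain h k where hk: "coprime h k" "\<bar>of_int k * (t / s) - of_int h\<bar> < 1 / real N"
    using Dirichlet_approx_coprime[of N "t / s"] by metis
  have "\<bar>s * of_int h - t * of_int k\<bar> = \<bar>s\<bar> * \<bar>of_int k * (t / s) - of_int h\<bar>"
    using False by (simp add: abs_mult[symmetric] algebra_simps)
  also have "\<dots> < \<bar>s\<bar> * (1 / real N)" using hk False by (intro mult_strict_left_mono) auto
  also have "\<dots> \<le> 1" using \<open>N > 0\<close> \<open>\<bar>s\<bar> \<le> real N\<close> by simp
  finally show thesis using that[of k h] hk by (simp add: coprime_commute)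
qed

locale tangency_frame =
  fixes x y z k :: lorentz
  assumes unit: "lor x x = 1" "lor y y = 1" "lor z z = 1"
    and touching: "touching x y" "touching x z" "touching y z"
    and k: "lor k k = 1" "lor k x = 0" "lor k y = 0" "lor k z = 0"
    and expand: "\<And>v. v = lor v x *\<^sub>R x - (lor v (x + z) / 2) *\<^sub>R (x + y)
           - (lor v (x + y) / 2) *\<^sub>R (x + z) + lor v k *\<^sub>R k"
begin

definition spin :: "real \<Rightarrow> real \<Rightarrow> lorentz" where
  "spin s t = s\<^sup>2 *\<^sub>R (x + y) + t\<^sup>2 *\<^sub>R (x + z) + (2 * s * t) *\<^sub>R k - x"

lemma lor_frame:
  "lor x y = -1" "lor x z = -1" "lor y z = -1" "lor y x = -1" "lor z x = -1" "lor z y = -1"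
  "lor x k = 0" "lor y k = 0" "lor z k = 0"
  using touching k by (auto simp: touching_def lor_commute)

lemma spin_uminus [simp]: "spin (- s) (- t) = spin s t"
  by (simp add: spin_def)

lemma spin_1_0: "spin 1 0 = y" and spin_0_1: "spin 0 1 = z"
  by (simp_all add: spin_def)

lemma lor_spin: "lor (spin s t) (spin s' t') = 1 - 2 * (s * t' - t * s')\<^sup>2"
  unfolding spin_def by (simp add: unit k lor_frame) (simp add: power2_eq_square algebra_simps)

lemma lor_spin_x: "lor (spin s t) x = -1" "lor x (spin s t) = -1"
  unfolding spin_def by (simp_all add: unit k lor_frame)

lemma lor_x_spin_self: "lor (x + spin s t) (x + spin s t) = 0"
  by (simp add: unit lor_spin lor_spin_x)

lemma future_x_spin: "future (x + spin s t)"
proof -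
  have f: "future (x + y)" by (rule touching_imp_future[OF unit(1,2) touching(1)])
  show ?thesis
  proof (cases "t = 0")
    case True
    then have "x + spin s t = s\<^sup>2 *\<^sub>R (x + y)" by (simp add: spin_def)
    then show ?thesis using f by (simp add: future_def del: scaleR_add_right)
  next
    case False
    have "lor (x + y) (x + spin s t) = - 2 * t\<^sup>2"
      unfolding spin_def by (simp add: unit k lor_frame)
    then have "lor (x + y) (x + spin s t) < 0" using False by simp
    moreover have "lor (x + y) (x + y) = 0" by (simp add: unit lor_frame)
    ultimately show ?thesis using future_transfer f lor_x_spin_self by metis
  qed
qed

lemma touching_x_spin:
  assumes "s \<noteq> 0 \<or> t \<noteq> 0" shows "touching x (spin s t)"
proof (rule future_imp_touching)
  have "lor (x + spin s t) (x + y) = - 2 * t\<^sup>2" "lor (x + spin s t) (x + z) = - 2 * s\<^sup>2"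
    unfolding spin_def by (simp_all add: unit k lor_frame)
  note lor_sum = this
  show "x + spin s t \<noteq> 0"
  proof
    assume "x + spin s t = 0"
    then show False using lor_sum assms by (simp only: lor_linear) auto
  qed
qed (simp_all add: unit lor_spin lor_spin_x future_x_spin)

lemma touching_spin:
  assumes det: "(s * t' - t * s')\<^sup>2 = 1" shows "touching (spin s t) (spin s' t')"
proof (rule future_imp_touching)
  have "(s' * t - t' * s)\<^sup>2 = 1" using det by (simp add: power2_commute mult.commute)
  then have l: "lor (spin s t) (spin s' t') = -1" "lor (spin s' t') (spin s t) = -1"
    using det by (simp_all add: lor_spin)
  have u: "lor (spin s t) (spin s t) = 1" "lor (spin s' t') (spin s' t') = 1"
    by (simp_all add: lor_spin)
  have lt: "lor (x + spin s t) (spin s t + spin s' t') = -2"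
    by (simp add: l u lor_spin_x)
  have null: "lor (spin s t + spin s' t') (spin s t + spin s' t') = 0"
    by (simp add: l u)
  show "future (spin s t + spin s' t')"
    by (rule future_transfer[OF lor_x_spin_self[of s t] future_x_spin null]) (simp add: l u lor_spin_x)
  show "spin s t + spin s' t' \<noteq> 0"
  proof
    assume "spin s t + spin s' t' = 0"
    then show False using lt by simp
  qed
  show "lor (spin s t) (spin s t) = 1" "lor (spin s' t') (spin s' t') = 1"
    "lor (spin s t) (spin s' t') = -1" by (fact u l)+
qed

lemma spin_sum_in_packing:
  assumes A: "apollonian_packing \<A>" and x: "x \<in> dvec ` \<A>"
    and v: "spin s t \<in> dvec ` \<A>" and w: "spin s' t' \<in> dvec ` \<A>" and det: "(s * t' - t * s')\<^sup>2 = 1"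
  shows "spin (s + s') (t + t') \<in> dvec ` \<A>"
proof -
  have nz: "s \<noteq> 0 \<or> t \<noteq> 0" "s' \<noteq> 0 \<or> t' \<noteq> 0" "s + s' \<noteq> 0 \<or> t + t' \<noteq> 0"
    using det by (auto simp: add_eq_0_iff)
  have "((s + s') * t - (t + t') * s)\<^sup>2 = (s * t' - t * s')\<^sup>2"
       "((s + s') * t' - (t + t') * s')\<^sup>2 = (s * t' - t * s')\<^sup>2" by algebra+
  note det' = this[unfolded det]
  show ?thesis
  proof (rule apollonian_packing_adjoin[OF A x v w])
    show "touching x (spin s t)" "touching x (spin s' t')" "touching (spin (s + s') (t + t')) x"
      using touching_x_spin nz by (simp_all add: touching_commute[of _ x])
    show "touching (spin s t) (spin s' t')" "touching (spin (s + s') (t + t')) (spin s t)"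
      "touching (spin (s + s') (t + t')) (spin s' t')"
      by (rule touching_spin, fact)+
  qed (simp add: lor_spin)
qed

lemma spin_in_packing:
  assumes A: "apollonian_packing \<A>" and x: "x \<in> dvec ` \<A>"
    and y: "y \<in> dvec ` \<A>" and z: "z \<in> dvec ` \<A>" and mn: "coprime (m::int) n"
  shows "spin (of_int m) (of_int n) \<in> dvec ` \<A>"
proof -
  have "spin (of_int m * s + of_int n * s') (of_int m * t + of_int n * t') \<in> dvec ` \<A>"
    if "coprime m n" "spin s t \<in> dvec ` \<A>" "spin s' t' \<in> dvec ` \<A>" "(s * t' - t * s')\<^sup>2 = 1"
    for m n :: int and s t s' t'
    using that
  proof (induction "nat (\<bar>m\<bar> + \<bar>n\<bar>)" arbitrary: m n s t s' t' rule: less_induct)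
    case less
    have neg: "spin (- s) (- t) \<in> dvec ` \<A>" "spin (- s') (- t') \<in> dvec ` \<A>" using less.prems by simp_all
    have det: "(s * (- t') - t * (- s'))\<^sup>2 = 1" "(- s * t' - (- t) * s')\<^sup>2 = 1"
      using less.prems(4) by (simp_all add: power2_eq_square algebra_simps)
    have sum: "spin (s + s') (t + t') \<in> dvec ` \<A>"
      using spin_sum_in_packing[OF A x] less.prems by blast
    have diff: "spin (s' - s) (t' - t) \<in> dvec ` \<A>" "spin (s - s') (t - t') \<in> dvec ` \<A>"
      using spin_sum_in_packing[OF A x neg(1) less.prems(3) det(2)]
        spin_sum_in_packing[OF A x less.prems(2) neg(2) det(1)] by simp_all
    have det': "(s * (t + t') - t * (s + s'))\<^sup>2 = 1" "((s + s') * t' - (t + t') * s')\<^sup>2 = 1"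
      "(s * (t' - t) - t * (s' - s))\<^sup>2 = 1" "((s - s') * t' - (t - t') * s')\<^sup>2 = 1"
      using less.prems(4) by (simp_all add: power2_eq_square algebra_simps)
    consider "m = 0" | "n = 0" | "m * n > 0" "\<bar>n\<bar> \<le> \<bar>m\<bar>" | "m * n > 0" "\<bar>m\<bar> < \<bar>n\<bar>"
      | "m * n < 0" "\<bar>n\<bar> \<le> \<bar>m\<bar>" | "m * n < 0" "\<bar>m\<bar> < \<bar>n\<bar>"
      by (metis linorder_cases linorder_not_le mult_eq_0_iff)
    then show ?case
    proof cases
      case 1
      then have "n = 1 \<or> n = -1" using less.prems(1) by auto
      then show ?thesis using 1 less.prems by auto
    next
      case 2
      then have "m = 1 \<or> m = -1" using less.prems(1) by auto
      then show ?thesis using 2 less.prems by auto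
    next
      case 3
      have size: "nat (\<bar>m - n\<bar> + \<bar>n\<bar>) < nat (\<bar>m\<bar> + \<bar>n\<bar>)"
        using 3 by (auto simp: zero_less_mult_iff)
      have cop: "coprime (m - n) n"
        using less.prems(1) by (metis coprime_iff_gcd_eq_1 gcd_diff1)
      show ?thesis
        using less.hyps[OF size cop less.prems(2) sum det'(1)] by (simp add: algebra_simps)
    next
      case 4
      have size: "nat (\<bar>m\<bar> + \<bar>n - m\<bar>) < nat (\<bar>m\<bar> + \<bar>n\<bar>)"
        using 4 by (auto simp: zero_less_mult_iff)
      have cop: "coprime m (n - m)"
        using less.prems(1) by (metis coprime_iff_gcd_eq_1 gcd_diff1 gcd.commute)
      show ?thesis
        using less.hyps[OF size cop sum less.prems(3) det'(2)] by (simp add: algebra_simps)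
    next
      case 5
      have size: "nat (\<bar>m + n\<bar> + \<bar>n\<bar>) < nat (\<bar>m\<bar> + \<bar>n\<bar>)"
        using 5 by (auto simp: mult_less_0_iff)
      have cop: "coprime (m + n) n"
        using less.prems(1) by (metis coprime_iff_gcd_eq_1 gcd_add1)
      show ?thesis
        using less.hyps[OF size cop less.prems(2) diff(1) det'(3)] by (simp add: algebra_simps)
    next
      case 6
      have size: "nat (\<bar>m\<bar> + \<bar>n + m\<bar>) < nat (\<bar>m\<bar> + \<bar>n\<bar>)"
        using 6 by (auto simp: mult_less_0_iff)
      have cop: "coprime m (n + m)"
        using less.prems(1) by (metis coprime_iff_gcd_eq_1 gcd_add1 gcd.commute)
      show ?thesis
        using less.hyps[OF size cop diff(2) less.prems(3) det'(4)] by (simp add: algebra_simps)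
    qed
  qed
  from this[OF mn, of 1 0 0 1] show ?thesis using y z by (simp add: spin_1_0 spin_0_1)
qed

lemma tangent_vector_is_spin:
  assumes v: "lor v v = 1" "lor v x = -1" and le: "lor v y \<le> 1" "lor v z \<le> 1"
  obtains s t where "v = spin s t"
proof -
  define \<alpha> \<beta> h where "\<alpha> = (1 - lor v z) / 2" and "\<beta> = (1 - lor v y) / 2" and "h = lor v k"
  have c: "lor (v + x) x = 0" "lor (v + x) (x + z) = - 2 * \<alpha>" "lor (v + x) (x + y) = - 2 * \<beta>"
    "lor (v + x) k = h"
    using v by (simp_all add: unit lor_frame \<alpha>_def \<beta>_def h_def)
  have "v + x = 0 *\<^sub>R x - (- 2 * \<alpha> / 2) *\<^sub>R (x + y) - (- 2 * \<beta> / 2) *\<^sub>R (x + z) + h *\<^sub>R k"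
    using expand[of "v + x"] unfolding c .
  then have ex: "v + x = \<alpha> *\<^sub>R (x + y) + \<beta> *\<^sub>R (x + z) + h *\<^sub>R k" by simp
  have "lor (v + x) (v + x) = 0" using v by (simp add: unit lor_commute[of x v])
  then have h: "h\<^sup>2 = 4 * \<alpha> * \<beta>"
    unfolding ex by (simp add: unit k lor_frame) (simp add: power2_eq_square algebra_simps)
  have nn: "\<alpha> \<ge> 0" "\<beta> \<ge> 0" using le by (simp_all add: \<alpha>_def \<beta>_def)
  define t where "t = (if h \<ge> 0 then sqrt \<beta> else - sqrt \<beta>)"
  have "\<bar>h\<bar> = sqrt (2\<^sup>2 * \<alpha> * \<beta>)" using h by (simp flip: real_sqrt_abs)
  then have "\<bar>h\<bar> = 2 * (sqrt \<alpha> * sqrt \<beta>)" by (simp add: real_sqrt_mult)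
  then have ht: "2 * sqrt \<alpha> * t = h" by (cases "h \<ge> 0") (simp_all add: t_def)
  have "t\<^sup>2 = \<beta>" using nn by (simp add: t_def)
  then have "v + x = spin (sqrt \<alpha>) t + x"
    unfolding ex spin_def ht using nn by simp
  then show thesis by (intro that[of "sqrt \<alpha>" t]) simp
qed

lemma fst_spin:
  "fst (spin s t) = s\<^sup>2 * (fst x + fst y) + t\<^sup>2 * (fst x + fst z) + 2 * s * t * fst k - fst x"
  by (simp add: spin_def)

end

section \<open>The curvature polynomial\<close>

lemma inner_square_complex:
  fixes u v :: complex
  shows "2 * (u \<bullet> v)\<^sup>2 = (norm u)\<^sup>2 * (norm v)\<^sup>2 + u\<^sup>2 \<bullet> v\<^sup>2"
  unfolding cmod_power2 by (simp add: inner_complex_def power2_eq_square algebra_simps)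

lemma spinor_squares_inner:
  assumes "lor x x = 1" "lor x y = -1" "lor x z = -1"
  shows "(fst x *\<^sub>R fst (snd y) - fst y *\<^sub>R fst (snd x)) \<bullet>
    (fst x *\<^sub>R fst (snd z) - fst z *\<^sub>R fst (snd x)) =
    (fst x)\<^sup>2 * lor y z + fst x * fst y + fst x * fst z + fst y * fst z"
proof -
  obtain A w C where x: "x = (A, w, C)" by (metis prod.exhaust)
  obtain A1 w1 C1 where y: "y = (A1, w1, C1)" by (metis prod.exhaust)
  obtain A2 w2 C2 where z: "z = (A2, w2, C2)" by (metis prod.exhaust)
  have ww: "w \<bullet> w = 1 + A * C" "w \<bullet> w1 = (A * C1 + A1 * C) / 2 - 1" "w \<bullet> w2 = (A * C2 + A2 * C) / 2 - 1"
    using assms by (simp_all add: x y z lor_def)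
  then have "w1 \<bullet> w = (A * C1 + A1 * C) / 2 - 1" by (simp add: inner_commute)
  then show ?thesis
    by (simp add: x y z lor_def inner_diff_left inner_diff_right ww)
       (simp add: power2_eq_square field_simps)
qed

lemma inner_spinors:
  assumes D: "is_disk D" "is_disk D1" "is_disk D2"
    and t: "tangent D D1" "tangent D D2" "tangent D1 D2"
    and u: "tangency_spinor D D1 u" and v: "tangency_spinor D D2 v"
  shows "(norm u)\<^sup>2 = curvature D + curvature D1" "(norm v)\<^sup>2 = curvature D + curvature D2"
    "(u \<bullet> v)\<^sup>2 = (curvature D + curvature D1) * (curvature D + curvature D2) - (curvature D)\<^sup>2"
proof -
  have l: "lor (dvec D) (dvec D) = 1" "lor (dvec D) (dvec D1) = -1" "lor (dvec D) (dvec D2) = -1"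
    "lor (dvec D1) (dvec D1) = 1" "lor (dvec D2) (dvec D2) = 1" "lor (dvec D1) (dvec D2) = -1"
    using D t by (simp_all add: lor_vec_self tangent_iff_touching touching_def)
  note uu = tangency_spinor_square[OF D(1,2) t(1) u] and vv = tangency_spinor_square[OF D(1,3) t(2) v]
  have nn: "curvature D + curvature D1 \<ge> 0" "curvature D + curvature D2 \<ge> 0"
    using t D by (auto simp: tangent_iff_touching touching_def)
  have "u\<^sup>2 \<bullet> u\<^sup>2 = (curvature D + curvature D1)\<^sup>2"
    using spinor_squares_inner[OF l(1,2,2)] unfolding uu
    by (simp add: l) (simp add: power2_eq_square algebra_simps)
  moreover have "u\<^sup>2 \<bullet> u\<^sup>2 = ((norm u)\<^sup>2)\<^sup>2"
    by (simp add: norm_power flip: power2_norm_eq_inner)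
  ultimately have "((norm u)\<^sup>2)\<^sup>2 = (curvature D + curvature D1)\<^sup>2" by simp
  then show nu: "(norm u)\<^sup>2 = curvature D + curvature D1"
    using nn by (auto intro: power2_eq_imp_eq)
  have "v\<^sup>2 \<bullet> v\<^sup>2 = (curvature D + curvature D2)\<^sup>2"
    using spinor_squares_inner[OF l(1,3,3)] unfolding vv
    by (simp add: l) (simp add: power2_eq_square algebra_simps)
  moreover have "v\<^sup>2 \<bullet> v\<^sup>2 = ((norm v)\<^sup>2)\<^sup>2"
    by (simp add: norm_power flip: power2_norm_eq_inner)
  ultimately have "((norm v)\<^sup>2)\<^sup>2 = (curvature D + curvature D2)\<^sup>2" by simp
  then show nv: "(norm v)\<^sup>2 = curvature D + curvature D2"
    using nn by (auto intro: power2_eq_imp_eq)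
  have "u\<^sup>2 \<bullet> v\<^sup>2 = (curvature D + curvature D1) * (curvature D + curvature D2) - 2 * (curvature D)\<^sup>2"
    using spinor_squares_inner[OF l(1-3)] unfolding uu vv
    by (simp add: l) (simp add: power2_eq_square algebra_simps)
  then show "(u \<bullet> v)\<^sup>2 = (curvature D + curvature D1) * (curvature D + curvature D2) - (curvature D)\<^sup>2"
    using inner_square_complex[of u v] nu nv by simp
qed

text \<open>Up to the factor \<open>-2\<close>, \<open>fst\<close> is the product with the null vector \<open>(0, 0, 1)\<close>. Expanding that
  vector in the frame determines \<open>fst k\<close> up to sign, and the sign of \<open>k\<close> matches the
  sign choices of the two spinors.\<close>

lemma tangency_frame_exists:
  assumes unit: "lor x x = 1" "lor y y = 1" "lor z z = 1"
    and t: "touching x y" "touching x z" "touching y z"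
    and g: "g\<^sup>2 = (fst x + fst y) * (fst x + fst z) - (fst x)\<^sup>2"
  obtains k where "tangency_frame x y z k" "fst k = g"
proof -
  have l: "lor x y = -1" "lor x z = -1" "lor y z = -1" using t by (simp_all add: touching_def)
  obtain k where k: "lor k k = 1" "lor k x = 0" "lor k y = 0" "lor k z = 0"
    and ex: "\<And>v. v = lor v x *\<^sub>R x - (lor v (x + z) / 2) *\<^sub>R (x + y)
           - (lor v (x + y) / 2) *\<^sub>R (x + z) + lor v k *\<^sub>R k"
    by (rule orthonormal_frame[OF unit l]) (rule that)
  have frame: "tangency_frame x y z k"
    by (intro tangency_frame.intro) (fact unit t k ex)+
  have frame': "tangency_frame x y z (- k)"
  proof (intro tangency_frame.intro)
    show "v = lor v x *\<^sub>R x - (lor v (x + z) / 2) *\<^sub>R (x + y)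
           - (lor v (x + y) / 2) *\<^sub>R (x + z) + lor v (- k) *\<^sub>R (- k)" for v
      using ex[of v] by (simp only: lor_linear scaleR_minus_left scaleR_minus_right minus_minus)
  qed (use unit t k in simp_all)
  have inf: "lor (0, 0, 1) v = - fst v / 2" for v :: lorentz by (simp add: lor_def)
  have "(0 :: real) = fst ((0, 0, 1) :: lorentz)" by simp
  also have "\<dots> = fst (lor (0, 0, 1) x *\<^sub>R x - (lor (0, 0, 1) (x + z) / 2) *\<^sub>R (x + y)
           - (lor (0, 0, 1) (x + y) / 2) *\<^sub>R (x + z) + lor (0, 0, 1) k *\<^sub>R k)"
    by (rule arg_cong[OF ex])
  finally have "(fst k)\<^sup>2 = (fst x + fst y) * (fst x + fst z) - (fst x)\<^sup>2"
    unfolding inf by (simp add: power2_eq_square field_simps)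
  then have "fst k = g \<or> fst k = - g" using g by (metis power2_eq_iff)
  then show thesis using that[OF frame] that[OF frame'] by auto
qed

theorem proposition3p4:
  fixes \<A> :: "gdisk set" and D D1 D2 :: gdisk
    and a b c d B :: real
    and M :: "real^2^2" and P :: "int \<times> int \<Rightarrow> real"
  assumes packing: "apollonian_packing \<A>"
    and D: "D \<in> \<A>" "B = curvature D"
    and neighbors: "D1 \<in> corona \<A> D" "D2 \<in> corona \<A> D" "tangent D1 D2"
    and u: "tangency_spinor D D1 (Complex a b)"
    and v: "tangency_spinor D D2 (Complex c d)"
    and M: "M = vector [vector [a, c], vector [b, d]]"
    and P: "\<And>m n. P (m, n) =
      (let f = vector [of_int m, of_int n] :: real^2
       in f \<bullet> ((transpose M ** M) *v f) - B)"
  shows "curvature ` corona \<A> D = {P (m, n) | m n. coprime m n}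
    \<and> (\<forall>m n. P (- m, - n) = P (m, n))
    \<and> (\<exists>\<phi>. \<phi> ` {(m, n). coprime m n} = corona \<A> D
         \<and> (\<forall>m n. coprime m n \<longrightarrow> curvature (\<phi> (m, n)) = P (m, n))
         \<and> (\<forall>m n m' n'. coprime m n \<longrightarrow> coprime m' n' \<longrightarrow>
              (\<phi> (m, n) = \<phi> (m', n') \<longleftrightarrow> (m', n') = (m, n) \<or> (m', n') = (- m, - n))))"
proof -
  note disk = apollonian_packing_disk[OF packing]
  have A: "D1 \<in> \<A>" "D2 \<in> \<A>" and t: "tangent D D1" "tangent D D2"
    using neighbors by (simp_all add: corona_def)
  have disks: "is_disk D" "is_disk D1" "is_disk D2" using disk D A by simp_all
  note inner = inner_spinors[OF disks t neighbors(3) u v]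
  obtain k where "tangency_frame (dvec D) (dvec D1) (dvec D2) k"
    and fst_k: "fst k = Complex a b \<bullet> Complex c d"
    by (rule tangency_frame_exists[of "dvec D" "dvec D1" "dvec D2" "Complex a b \<bullet> Complex c d"])
       (use disks t neighbors(3) inner(3) in \<open>simp_all add: lor_vec_self tangent_iff_touching\<close>)
  then interpret tangency_frame "dvec D" "dvec D1" "dvec D2" k by simp
  have P_eq: "P (m, n) = (of_int m)\<^sup>2 * (a\<^sup>2 + b\<^sup>2) + (of_int n)\<^sup>2 * (c\<^sup>2 + d\<^sup>2)
      + 2 * of_int m * of_int n * (a * c + b * d) - B" for m n
    unfolding P M
    by (simp add: Let_def inner_vec_def matrix_vector_mult_def matrix_matrix_mult_def transpose_def
        sum_2 vector_2 power2_eq_square algebra_simps)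
  define \<phi> where "\<phi> = (\<lambda>(m, n). SOME E. is_disk E \<and> dvec E = spin (of_int m) (of_int n))"
  have \<phi>: "is_disk (\<phi> (m, n))" "dvec (\<phi> (m, n)) = spin (of_int m) (of_int n)" for m n
  proof -
    have "\<exists>E. is_disk E \<and> dvec E = spin (of_int m) (of_int n)"
      by (rule dvec_surject) (simp add: lor_spin)
    then have "is_disk (\<phi> (m, n)) \<and> dvec (\<phi> (m, n)) = spin (of_int m) (of_int n)"
      unfolding \<phi>_def prod.case by (rule someI_ex)
    then show "is_disk (\<phi> (m, n))" "dvec (\<phi> (m, n)) = spin (of_int m) (of_int n)" by simp_all
  qed
  have curv: "curvature (\<phi> (m, n)) = P (m, n)" for m n
    using inner(1,2) by (simp add: P_eq \<phi>(2) fst_spin fst_k D(2) cmod_power2 inner_complex_def flip: fst_vec)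
  have in_A: "\<phi> (m, n) \<in> \<A>" if "coprime m n" for m n
  proof -
    have "spin (of_int m) (of_int n) \<in> dvec ` \<A>"
      using spin_in_packing[OF packing _ _ _ that] D A by blast
    then obtain E where "E \<in> \<A>" "dvec E = dvec (\<phi> (m, n))" by (auto simp: \<phi>(2))
    then show ?thesis using dvec_inject \<phi>(1) disk by metis
  qed
  have in_corona: "\<phi> (m, n) \<in> corona \<A> D" if "coprime m n" for m n
  proof -
    have "m \<noteq> 0 \<or> n \<noteq> 0" using that by auto
    then have "touching (dvec D) (dvec (\<phi> (m, n)))"
      unfolding \<phi>(2) by (intro touching_x_spin) simp
    then show ?thesis
      using in_A[OF that] \<phi>(1) disks by (simp add: corona_def tangent_iff_touching)
  qed
  have onto: "\<exists>m n. coprime m n \<and> E = \<phi> (m, n)" if "E \<in> corona \<A> D" for E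
  proof -
    have E: "E \<in> \<A>" "is_disk E" and "tangent D E" using that disk by (simp_all add: corona_def)
    then have "lor (dvec E) (dvec D) = -1"
      using disks by (simp add: tangent_iff_touching touching_def lor_commute)
    moreover have "lor (dvec E) (dvec X) \<le> 1" if "X \<in> \<A>" for X
      using apollonian_packing_separated[OF packing E(1) that] lor_vec_self[OF E(2)] by auto
    ultimately obtain s t where st: "dvec E = spin s t"
      using tangent_vector_is_spin lor_vec_self[OF E(2)] A by metis
    obtain m n :: int where mn: "coprime m n" "\<bar>s * of_int n - t * of_int m\<bar> < 1"
      by (rule coprime_approximation)
    have "(s * of_int n - t * of_int m)\<^sup>2 < 1" using mn(2) by (simp add: abs_square_less_1)
    then have "lor (dvec E) (dvec (\<phi> (m, n))) > -1"
      by (simp add: st \<phi>(2) lor_spin)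
    then have "E = \<phi> (m, n)"
      using apollonian_packing_separated[OF packing E(1) in_A[OF mn(1)]] by auto
    then show ?thesis using mn by blast
  qed
  have inj: "\<phi> (m, n) = \<phi> (m', n') \<longleftrightarrow> (m', n') = (m, n) \<or> (m', n') = (- m, - n)"
    if "coprime m n" "coprime m' n'" for m n m' n'
  proof
    assume "\<phi> (m, n) = \<phi> (m', n')"
    then have "lor (spin (of_int m) (of_int n)) (spin (of_int m') (of_int n')) = 1"
      using \<phi>(2) lor_vec_self \<phi>(1) by metis
    then have "real_of_int m * of_int n' - of_int n * of_int m' = 0" by (simp add: lor_spin)
    then have eq: "m * n' = m' * n" by (metis eq_iff_diff_eq_0 mult.commute of_int_eq_iff of_int_mult)
    then have "\<bar>m\<bar> * \<bar>n'\<bar> = \<bar>m'\<bar> * \<bar>n\<bar>" by (metis abs_mult)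
    then have "\<bar>m\<bar> * \<bar>n'\<bar> = \<bar>m'\<bar> * \<bar>n\<bar>" by (metis abs_mult)
    then have "\<bar>m\<bar> = \<bar>m'\<bar> \<and> \<bar>n\<bar> = \<bar>n'\<bar>"
      using that coprime_crossproduct_int[of m n m' n'] by (simp add: mult.commute coprime_commute)
    then show "(m', n') = (m, n) \<or> (m', n') = (- m, - n)"
      using eq by (auto simp: abs_eq_iff)
  next
    assume "(m', n') = (m, n) \<or> (m', n') = (- m, - n)"
    then have "dvec (\<phi> (m', n')) = dvec (\<phi> (m, n))" by (auto simp: \<phi>(2))
    then show "\<phi> (m, n) = \<phi> (m', n')" using dvec_inject \<phi>(1) by metis
  qed
  have image: "\<phi> ` {(m, n). coprime m n} = corona \<A> D"
    using in_corona onto by fastforce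
  have "curvature ` corona \<A> D = {P (m, n) | m n. coprime m n}"
    unfolding image[symmetric] using curv by (auto simp: image_iff) blast
  then show ?thesis
    using image curv inj by (intro conjI exI[of _ \<phi>]) (simp_all add: P_eq)
qed

end
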